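(* Let $G=(V,E\cup A)$ be a mixed graph and $k\ge 1$ an integer such that $E\cup A$ can be partitioned into $k$ matching forests. Then $E\cup A$ can be partitioned into $k$ matching forests $F_1,\dots,F_k$ such that, writing $M_i:=F_i\cap E$ and $B_i:=F_i\cap A$, for every $i,j\in\{1,\dots,k\}$ we have $\big||F_i|-|F_j|\big|\le 1$, $\big||M_i|-|M_j|\big|\le 2$, and $\big||B_i|-|B_j|\big|\le 2$.
   Context: A mixed graph $G=(V,E\cup A)$ has a finite vertex set $V$, a set $E$ of undirected edges and a set $A$ of directed arcs; there are no loops, but parallel edges/arcs are allowed. Each arc has one head (its head vertex); both endpoints of an edge are regarded as heads of that edge. A vertex $v$ is covered by $e\in E\cup A$ if $v$ is a head of $e$. A matching forest is a subset $F\subseteq E\cup A$ such that (i) the underlying undirected graph of $F$ has no cycle and (ii) every vertex of $V$ is covered at most once in $F$ (i.e., is a head of at most one element of $F$). *)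

theory Defs
  imports Main "HOL-Library.Disjoint_Sets"
begin

text \<open>
  Undirected edges and directed arcs are elements of one type of names with explicit incidence
  functions, so parallel edges and parallel arcs are allowed. \<open>ends\<close> is meaningful only on
  undirected edges, \<open>tail\<close> and \<open>head\<close> only on arcs.
\<close>

record ('v, 'e) mixed_graph =
  verts :: "'v set"
  edges :: "'e set"
  arcs  :: "'e set"
  ends  :: "'e \<Rightarrow> 'v set"
  tail  :: "'e \<Rightarrow> 'v"
  head  :: "'e \<Rightarrow> 'v"

locale mixed_graph =
  fixes G :: "('v, 'e) mixed_graph"
  assumes finite_verts: "finite (verts G)"
    and edges_arcs_disjoint: "edges G \<inter> arcs G = {}"
    and ends_subset: "e \<in> edges G \<Longrightarrow> ends G e \<subseteq> verts G"
    and card_ends: "e \<in> edges G \<Longrightarrow> card (ends G e) = 2"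
    and tail_in_verts: "a \<in> arcs G \<Longrightarrow> tail G a \<in> verts G"
    and head_in_verts: "a \<in> arcs G \<Longrightarrow> head G a \<in> verts G"
    and tail_neq_head: "a \<in> arcs G \<Longrightarrow> tail G a \<noteq> head G a"

definition heads :: "('v, 'e) mixed_graph \<Rightarrow> 'e \<Rightarrow> 'v set" where
  "heads G e = (if e \<in> edges G then ends G e else {head G e})"

definition underlying_ends :: "('v, 'e) mixed_graph \<Rightarrow> 'e \<Rightarrow> 'v set" where
  "underlying_ends G e = (if e \<in> edges G then ends G e else {tail G e, head G e})"

text \<open>
  The cycle visits the vertices \<open>vs\<close> in order and returns to the first one, using \<open>es ! i\<close> to leave
  \<open>vs ! i\<close>. Distinctness of \<open>es\<close> matters for length two: two different parallel elements form a
  cycle, whereas one element traversed back and forth does not.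
\<close>

definition is_cycle :: "('v, 'e) mixed_graph \<Rightarrow> 'v list \<Rightarrow> 'e list \<Rightarrow> bool" where
  "is_cycle G vs es \<longleftrightarrow>
     es \<noteq> [] \<and> length vs = length es \<and> distinct vs \<and> distinct es \<and>
     (\<forall>i<length es. underlying_ends G (es ! i) = {vs ! i, vs ! (Suc i mod length es)})"

definition matching_forest :: "('v, 'e) mixed_graph \<Rightarrow> 'e set \<Rightarrow> bool" where
  "matching_forest G F \<longleftrightarrow>
     F \<subseteq> edges G \<union> arcs G \<and>
     (\<nexists>vs es. is_cycle G vs es \<and> set es \<subseteq> F) \<and>
     (\<forall>v\<in>verts G. \<forall>e\<in>F. \<forall>f\<in>F. v \<in> heads G e \<longrightarrow> v \<in> heads G f \<longrightarrow> e = f)"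

text \<open>Parts are indexed and may be empty.\<close>

definition matching_forest_partition ::
    "('v, 'e) mixed_graph \<Rightarrow> nat \<Rightarrow> (nat \<Rightarrow> 'e set) \<Rightarrow> bool" where
  "matching_forest_partition G k F \<longleftrightarrow>
     (\<forall>i\<in>{1..k}. matching_forest G (F i)) \<and>
     disjoint_family_on F {1..k} \<and>
     (\<Union>i\<in>{1..k}. F i) = edges G \<union> arcs G"

text \<open>
  Finiteness of the edge and arc sets is not assumed; it follows once they are partitioned into
  finitely many matching forests, so \<open>card\<close> of a part is its true size.
\<close>

lemma (in mixed_graph) finite_matching_forest:
  assumes "matching_forest G F"
  shows "finite F"
proof -
  have ex: "\<exists>v. v \<in> verts G \<and> v \<in> heads G e" if "e \<in> F" for e
  proof (cases "e \<in> edges G")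
    case True
    then have "ends G e \<noteq> {}"
      using card_ends by force
    then show ?thesis
      using True ends_subset by (auto simp: heads_def)
  next
    case False
    then show ?thesis
      using assms that head_in_verts by (auto simp: heads_def matching_forest_def)
  qed
  define h where "h e = (SOME v. v \<in> verts G \<and> v \<in> heads G e)" for e
  have h: "h e \<in> verts G \<and> h e \<in> heads G e" if "e \<in> F" for e
    unfolding h_def by (rule someI_ex[OF ex[OF that]])
  have "inj_on h F"
    using assms h unfolding inj_on_def matching_forest_def by metis
  moreover have "h ` F \<subseteq> verts G"
    using h by blast
  ultimately show ?thesis
    using finite_verts finite_subset finite_imageD by metis
qed

end

theory Submission
  imports Defs
begin

text \<open>
  A partition minimising the sum of \<open>3 |F|\<^sup>2 + |M|\<^sup>2 + |B|\<^sup>2\<close> over its parts is as desired, provided that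
  two disjoint matching forests can always be rebalanced within their union.

  For two forests, let \<open>R\<^sub>1, R\<^sub>2\<close> be the root sets of their branchings. By Edmonds' theorem, other root
  sets with the same union and intersection are realised by the same arcs as soon as both meet every
  minimal vertex set that no arc enters. Choose in each such set a root of either branching and tie
  the two together, and tie the ends of every matching edge together. The ties form paths and cycles
  along which the two forests can be exchanged independently. Two kinds of ties alternate along a
  path, so exchanging one changes \<open>|F\<^sub>1| - |F\<^sub>2|\<close> and \<open>|M\<^sub>1| - |M\<^sub>2|\<close> by at most 2 each. Hence one has to
  choose signs for vectors with entries in \<open>{-1, 0, 1}\<close>.
\<close>

subsection \<open>Branchings with prescribed roots\<close>

definition enters :: "('e \<Rightarrow> 'v) \<Rightarrow> ('e \<Rightarrow> 'v) \<Rightarrow> 'v set \<Rightarrow> 'e \<Rightarrow> bool" where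
  "enters t h U a \<longleftrightarrow> h a \<in> U \<and> t a \<notin> U"

text \<open>Reachability in cut form: when all tails of \<open>B\<close> lie in \<open>V\<close>, it
  says that every vertex of \<open>V\<close> is reached from \<open>R\<close> along arcs of
  \<open>B\<close>. Cuts are what the uncrossing arguments work with.\<close>

definition spanning :: "('e \<Rightarrow> 'v) \<Rightarrow> ('e \<Rightarrow> 'v) \<Rightarrow> 'v set \<Rightarrow> 'v set \<Rightarrow> 'e set \<Rightarrow> bool" where
  "spanning t h V R B \<longleftrightarrow>
     (\<forall>U\<subseteq>V. U \<noteq> {} \<longrightarrow> U \<inter> R = {} \<longrightarrow> (\<exists>a\<in>B. enters t h U a))"

text \<open>For \<open>R\<close> inside \<open>V\<close>, one entering arc at each non-root together
  with reachability from \<open>R\<close> describes a forest of arborescences with root set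
  \<open>R\<close>, without mention of cycles.\<close>

definition branching :: "('e \<Rightarrow> 'v) \<Rightarrow> ('e \<Rightarrow> 'v) \<Rightarrow> 'v set \<Rightarrow> 'v set \<Rightarrow> 'e set \<Rightarrow> bool" where
  "branching t h V R B \<longleftrightarrow> inj_on h B \<and> h ` B = V - R \<and> spanning t h V R B"

lemma minimal_subset:
  assumes "finite U" "Q U"
  obtains K where "K \<subseteq> U" "Q K" "\<And>L. L \<subseteq> K \<Longrightarrow> Q L \<Longrightarrow> L = K"
proof -
  have "finite {L. L \<subseteq> U \<and> Q L}"
    using assms(1) by simp
  then obtain K where "K \<in> {L. L \<subseteq> U \<and> Q L}" "\<forall>L\<in>{L. L \<subseteq> U \<and> Q L}. L \<subseteq> K \<longrightarrow> K = L"
    using finite_has_minimal[of "{L. L \<subseteq> U \<and> Q L}"] assms(2) by auto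
  then show ?thesis
    by (intro that[of K]) auto
qed

lemma spanningD:
  assumes "spanning t h V R B" "U \<subseteq> V" "U \<noteq> {}" "U \<inter> R = {}"
  obtains a where "a \<in> B" "enters t h U a"
  using assms unfolding spanning_def by blast

text \<open>If \<open>U\<close> is not contained in \<open>{h a}\<close>, some arc of
  \<open>B\<close> enters \<open>U - {h a}\<close>. Its tail lies in \<open>T\<close>, so it is not
  \<open>h a\<close>, and the arc enters \<open>U\<close> as well.\<close>

lemma spanning_insert:
  assumes "spanning t h T R B" and "h ` B \<subseteq> T" and "t ` B \<subseteq> T" and "t a \<in> T" and "h a \<notin> T"
  shows "spanning t h (insert (h a) T) R (insert a B)"
  unfolding spanning_def
proof (intro allI impI)
  fix U assume U: "U \<subseteq> insert (h a) T" "U \<noteq> {}" "U \<inter> R = {}"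
  show "\<exists>c\<in>insert a B. enters t h U c"
  proof (cases "U \<subseteq> {h a}")
    case True
    then have "enters t h U a"
      using U assms by (auto simp: enters_def)
    then show ?thesis by blast
  next
    case False
    then obtain c where "c \<in> B" "enters t h (U - {h a}) c"
      using spanningD[OF assms(1), of "U - {h a}"] U by blast
    then have "enters t h U c"
      using assms unfolding enters_def by auto
    then show ?thesis using \<open>c \<in> B\<close> by blast
  qed
qed

text \<open>
  Edmonds' disjoint branchings theorem for two root sets, by Lovasz's argument: the first branching
  grows one arc at a time, and an arc that may be used is found at an inclusion-minimal tight set.
\<close>

lemma growing_arc:
  fixes t h :: "'e \<Rightarrow> 'v"
  assumes fin: "finite V"
    and B: "h ` B \<subseteq> T" "t ` B \<subseteq> T" and RT: "R \<subseteq> T" and TV: "T \<subset> V"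
    and tA: "t ` A \<subseteq> V" and hA: "h ` A \<subseteq> V"
    and c1: "spanning t h V R A" and c2: "spanning t h V Q (A - B)"
    and c12: "\<And>U. U \<subseteq> V \<Longrightarrow> U \<noteq> {} \<Longrightarrow> U \<inter> (R \<union> Q) = {} \<Longrightarrow>
                \<exists>a\<in>A. \<exists>b\<in>A. a \<noteq> b \<and> enters t h U a \<and> enters t h U b"
  obtains a where "a \<in> A - B" "t a \<in> T" "h a \<notin> T" "spanning t h V Q (A - insert a B)"
proof -
  \<comment> \<open>Tight sets are the obstructions: at most one remaining arc enters such a set, so
    using that arc would cut the set off from \<open>Q\<close>.\<close>
  define tight where "tight U \<longleftrightarrow> U \<subseteq> V \<and> U - T \<noteq> {} \<and> U \<inter> Q = {} \<and>
      (\<exists>c. \<forall>a\<in>A - B. enters t h U a \<longrightarrow> a = c)" for U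
  have breaks: "\<exists>U. tight U \<and> enters t h U a \<and> (\<forall>b\<in>A - B. enters t h U b \<longrightarrow> b = a)"
    if a: "a \<in> A - B" "h a \<notin> T" "\<not> spanning t h V Q (A - insert a B)" for a
  proof -
    obtain U where U: "U \<subseteq> V" "U \<noteq> {}" "U \<inter> Q = {}" "\<forall>b\<in>A - insert a B. \<not> enters t h U b"
      using a(3) unfolding spanning_def by blast
    obtain b where "b \<in> A - B" "enters t h U b"
      using spanningD[OF c2 U(1-3)] by blast
    with U have "enters t h U a" by blast
    then have "tight U \<and> enters t h U a \<and> (\<forall>b\<in>A - B. enters t h U b \<longrightarrow> b = a)"
      using U a(2) unfolding tight_def enters_def by blast
    then show ?thesis by blast
  qed
  show ?thesis
  proof (cases "\<exists>U. tight U")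
    case False
    obtain a where a: "a \<in> A" "enters t h (V - T) a"
      using spanningD[OF c1, of "V - T"] RT TV by blast
    then have "a \<in> A - B" "t a \<in> T" "h a \<notin> T"
      using B tA by (auto simp: enters_def)
    then show ?thesis
      using that breaks[of a] False by blast
  next
    case True
    have "finite {U. tight U}"
      using fin by (rule_tac finite_subset[of _ "Pow V"]) (auto simp: tight_def)
    then obtain U where U: "tight U" and min: "\<And>W. tight W \<Longrightarrow> W \<subseteq> U \<Longrightarrow> W = U"
      using finite_has_minimal[of "{U. tight U}"] True by auto
    then obtain c where c: "\<forall>a\<in>A - B. enters t h U a \<longrightarrow> a = c"
      unfolding tight_def by blast
    \<comment> \<open>\<open>U - T\<close> avoids both root sets, so one of two entering arcs
      differs from \<open>c\<close>. That arc does not enter \<open>U\<close>, so its tail lies in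
      \<open>U\<close> and hence in \<open>T\<close>.\<close>
    have "\<exists>a\<in>A. \<exists>b\<in>A. a \<noteq> b \<and> enters t h (U - T) a \<and> enters t h (U - T) b"
      using U RT by (intro c12) (auto simp: tight_def)
    then obtain a where a: "a \<in> A" "a \<noteq> c" "enters t h (U - T) a"
      by metis
    have aB: "a \<in> A - B" "h a \<notin> T"
      using a B by (auto simp: enters_def)
    then have tU: "t a \<in> U"
      using a c unfolding enters_def by blast
    then have tT: "t a \<in> T"
      using a by (auto simp: enters_def)
    have "spanning t h V Q (A - insert a B)"
    proof (rule ccontr)
      assume "\<not> ?thesis"
      then obtain W where W: "tight W" "enters t h W a"
        "\<forall>b\<in>A - B. enters t h W b \<longrightarrow> b = a"
        using breaks[OF aB] by blast
      \<comment> \<open>Uncrossing: a second arc into \<open>U \<inter> W\<close> would be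
        \<open>c\<close> with its tail in \<open>W\<close>, whereas the tail of \<open>a\<close> is
        in \<open>U\<close>; then no remaining arc could enter \<open>U \<union> W\<close>. So
        \<open>U \<inter> W\<close> is tight, against the minimality of \<open>U\<close>.\<close>
      have "b = a" if b: "b \<in> A - B" "enters t h (U \<inter> W) b" for b
      proof (rule ccontr)
        assume "b \<noteq> a"
        then have bW: "t b \<in> W" "b = c"
          using b W c unfolding enters_def by auto
        have "U \<union> W \<subseteq> V" "U \<union> W \<noteq> {}" "(U \<union> W) \<inter> Q = {}"
          using U W(1) unfolding tight_def by blast+
        from spanningD[OF c2 this] obtain d where d: "d \<in> A - B" "enters t h (U \<union> W) d"
          by blast
        then have "d = c \<or> d = a"
          using c W(3) unfolding enters_def by blast
        then show False
          using d bW tU unfolding enters_def by blast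
      qed
      then have "tight (U \<inter> W)"
        using U W aB a unfolding tight_def enters_def by blast
      then have "U \<inter> W = U"
        using min by blast
      then show False
        using tU W(2) unfolding enters_def by blast
    qed
    then show ?thesis
      using that aB tT by blast
  qed
qed

text \<open>A maximal partial branching must cover \<open>V\<close>, since otherwise
  \<open>growing_arc\<close> extends it. The remaining arcs are only asked to span from
  \<open>Q\<close>; that they form a branching is a count of heads, made where the root sets are
  exchanged.\<close>

lemma disjoint_branchings:
  fixes t h :: "'e \<Rightarrow> 'v"
  assumes fin: "finite V" "finite A" and RV: "R \<subseteq> V"
    and tA: "t ` A \<subseteq> V" and hA: "h ` A \<subseteq> V"
    and c1: "spanning t h V R A" and c2: "spanning t h V Q A"
    and c12: "\<And>U. U \<subseteq> V \<Longrightarrow> U \<noteq> {} \<Longrightarrow> U \<inter> (R \<union> Q) = {} \<Longrightarrow>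
                \<exists>a\<in>A. \<exists>b\<in>A. a \<noteq> b \<and> enters t h U a \<and> enters t h U b"
  obtains B where "B \<subseteq> A" "branching t h V R B" "spanning t h V Q (A - B)"
proof -
  define partial where "partial B \<longleftrightarrow> B \<subseteq> A \<and> inj_on h B \<and> h ` B \<inter> R = {} \<and>
      t ` B \<subseteq> R \<union> h ` B \<and> spanning t h (R \<union> h ` B) R B \<and> spanning t h V Q (A - B)" for B
  have "partial {}"
    using c2 by (auto simp: partial_def spanning_def)
  moreover have "finite {B. partial B}"
    using fin by (rule_tac finite_subset[of _ "Pow A"]) (auto simp: partial_def)
  ultimately obtain B where B: "partial B" and max: "\<And>C. partial C \<Longrightarrow> B \<subseteq> C \<Longrightarrow> C = B"
    using finite_has_maximal[of "{B. partial B}"] by auto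
  define T where "T = R \<union> h ` B"
  have BT: "B \<subseteq> A" "inj_on h B" "h ` B \<inter> R = {}" "t ` B \<subseteq> T" "h ` B \<subseteq> T" "R \<subseteq> T"
    "spanning t h T R B" "spanning t h V Q (A - B)"
    using B by (auto simp: partial_def T_def)
  have "T = V"
  proof (rule ccontr)
    assume "T \<noteq> V"
    then have TV: "T \<subset> V"
      using RV BT(1) hA by (auto simp: T_def)
    obtain a where a: "a \<in> A - B" "t a \<in> T" "h a \<notin> T" "spanning t h V Q (A - insert a B)"
      using growing_arc[OF fin(1) BT(5,4,6) TV tA hA c1 BT(8) c12] by blast
    have "partial (insert a B)"
      using spanning_insert[OF BT(7,5,4) a(2,3)] a BT
      unfolding partial_def T_def by auto
    then show False
      using max[of "insert a B"] a by blast
  qed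
  then have "branching t h V R B"
    using BT hA by (auto simp: branching_def T_def)
  then show ?thesis
    using that BT by blast
qed

text \<open>
  A set that no arc enters contains a minimal such set, so it is enough that both new root sets
  meet the minimal ones.
\<close>

lemma branching_roots_exchange:
  fixes t h :: "'e \<Rightarrow> 'v" and R R' :: "bool \<Rightarrow> 'v set"
  assumes fin: "finite V" "finite A"
    and tA: "t ` A \<subseteq> V"
    and br: "\<And>i. branching t h V (R i) (B i)" and RV: "\<And>i. R i \<subseteq> V"
    and A: "A = B True \<union> B False" and disj: "B True \<inter> B False = {}"
    and R': "R' True \<union> R' False = R True \<union> R False" "R' True \<inter> R' False = R True \<inter> R False"
    and meets: "\<And>K i. K \<subseteq> V \<Longrightarrow> K \<noteq> {} \<Longrightarrow> (\<forall>a\<in>A. \<not> enters t h K a) \<Longrightarrow>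
       (\<And>L. L \<subseteq> K \<Longrightarrow> L \<noteq> {} \<Longrightarrow> (\<forall>a\<in>A. \<not> enters t h L a) \<Longrightarrow> L = K) \<Longrightarrow> K \<inter> R' i \<noteq> {}"
  obtains B' where "\<And>i. branching t h V (R' i) (B' i)"
    "B' True \<union> B' False = A" "B' True \<inter> B' False = {}"
proof -
  have hB: "inj_on h (B i)" "h ` B i = V - R i" "spanning t h V (R i) (B i)" for i
    using br[of i] by (auto simp: branching_def)
  have Ui: "Z i \<subseteq> Z True \<union> Z False" for Z :: "bool \<Rightarrow> 'v set" and i
    by (cases i) auto
  have span: "spanning t h V (R' i) A" for i
    unfolding spanning_def
  proof (intro allI impI, rule ccontr)
    fix U assume U: "U \<subseteq> V" "U \<noteq> {}" "U \<inter> R' i = {}" "\<not> (\<exists>a\<in>A. enters t h U a)"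
    have "finite U" using U(1) fin(1) by (rule finite_subset)
    then obtain K where K: "K \<subseteq> U" "K \<noteq> {} \<and> (\<forall>a\<in>A. \<not> enters t h K a)"
      "\<And>L. L \<subseteq> K \<Longrightarrow> L \<noteq> {} \<and> (\<forall>a\<in>A. \<not> enters t h L a) \<Longrightarrow> L = K"
      using minimal_subset[of U "\<lambda>L. L \<noteq> {} \<and> (\<forall>a\<in>A. \<not> enters t h L a)"] U by metis
    have "K \<inter> R' i \<noteq> {}"
      by (rule meets) (use K U in auto)
    then show False using K U by blast
  qed
  \<comment> \<open>The union of the root sets is unchanged, so \<open>U\<close> avoids both old
    root sets and each old branching supplies one arc.\<close>
  have two: "\<exists>a\<in>A. \<exists>b\<in>A. a \<noteq> b \<and> enters t h U a \<and> enters t h U b"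
    if U: "U \<subseteq> V" "U \<noteq> {}" "U \<inter> (R' True \<union> R' False) = {}" for U
  proof -
    have "\<exists>a\<in>B i. enters t h U a" for i
    proof -
      have "U \<inter> R i = {}" using U(3) R'(1) Ui[of R i] by auto
      then show ?thesis using spanningD[OF hB(3)[of i] U(1,2)] by metis
    qed
    from this[of True] this[of False] obtain a b where
      ab: "a \<in> B True" "enters t h U a" "b \<in> B False" "enters t h U b"
      by blast
    then have "a \<noteq> b" "a \<in> A" "b \<in> A"
      using A disj by auto
    with ab show ?thesis by blast
  qed
  have R'V: "R' i \<subseteq> V" for i
    using RV[of True] RV[of False] R'(1) Ui[of R' i] by auto
  have hA: "h ` A \<subseteq> V" using hB(2) A by blast
  obtain C where C: "C \<subseteq> A" "branching t h V (R' True) C" "spanning t h V (R' False) (A - C)"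
    using disjoint_branchings[OF fin R'V tA hA span span two] by blast
  have hC: "inj_on h C" "h ` C = V - R' True"
    using C(2) by (auto simp: branching_def)
  \<comment> \<open>A vertex is the head of at most two arcs of \<open>A\<close>, of at most one if
    it is an old root, and of none if it is a root of both branchings. The new root sets have the
    same multiplicities, so the heads left over by \<open>C\<close> are distinct and avoid
    \<open>R' False\<close>.\<close>
  have single: "a = b" if "a \<in> A" "b \<in> A" "h a = h b" "h a \<in> R True \<union> R False" for a b
    using that A hB(1,2) unfolding inj_on_def by blast
  have three: "a = b \<or> b = c \<or> a = c" if "a \<in> A" "b \<in> A" "c \<in> A" "h a = h b" "h b = h c" for a b c
  proof -
    have "a \<in> B True \<or> a \<in> B False" "b \<in> B True \<or> b \<in> B False" "c \<in> B True \<or> c \<in> B False"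
      using that A by auto
    then show ?thesis
      using that(4,5) hB(1)[of True] hB(1)[of False] unfolding inj_on_def by (elim disjE) auto
  qed
  have none: "h a \<notin> R True \<inter> R False" if "a \<in> A" for a
    using that A hB(2)[of True] hB(2)[of False] by blast
  have cov: "\<exists>c\<in>C. h c = v" if "v \<in> V - R' True" for v
    using that hC(2) by (metis imageE)
  have "inj_on h (A - C)"
  proof (rule inj_onI)
    fix a b assume ab: "a \<in> A - C" "b \<in> A - C" "h a = h b"
    show "a = b"
    proof (cases "h a \<in> R' True")
      case True
      then show ?thesis using single ab R'(1) by blast
    next
      case False
      then obtain c where c: "c \<in> C" "h c = h a"
        using cov hA ab by blast
      then have "c \<in> A" "c \<noteq> a" "c \<noteq> b" using ab C(1) by blast+
      then show ?thesis using three[of a b c] ab c(2) by (metis DiffD1)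
    qed
  qed
  moreover have "h ` (A - C) = V - R' False"
  proof (intro equalityI subsetI)
    fix v assume "v \<in> h ` (A - C)"
    then obtain a where a: "a \<in> A - C" "v = h a" by blast
    have "v \<notin> R' False"
    proof
      assume v: "v \<in> R' False"
      show False
      proof (cases "v \<in> R' True")
        case True
        then show ?thesis using v none a R'(2) by blast
      next
        case False
        then obtain c where c: "c \<in> C" "h c = v"
          using cov hA a by blast
        then have "c \<in> A" "c \<noteq> a" using a C(1) by blast+
        moreover have "v \<in> R True \<union> R False" using v R'(1) by blast
        ultimately show ?thesis using single[of a c] a c(2) by (metis DiffD1)
      qed
    qed
    then show "v \<in> V - R' False" using a hA by blast
  next
    fix v assume "v \<in> V - R' False"
    then obtain a where "a \<in> A - C" "enters t h {v} a"
      using spanningD[OF C(3), of "{v}"] by blast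
    then show "v \<in> h ` (A - C)" by (auto simp: enters_def)
  qed
  ultimately have "branching t h V (R' False) (A - C)"
    using C(3) by (simp add: branching_def)
  then show ?thesis
    by (intro that[of "\<lambda>i. if i then C else A - C"]) (use C(1,2) in auto)
qed

subsection \<open>Balancing along paths\<close>

lemma abs_le_1_cases: "\<bar>x::int\<bar> \<le> 1 \<Longrightarrow> x = -1 \<or> x = 0 \<or> x = 1" by arith

text \<open>
  Two sign vectors have a sum or a difference that is again one, except \<open>(1, 1)\<close> and \<open>(1, -1)\<close>
  up to sign; these two give both \<open>(2, 0)\<close> and \<open>(0, 2)\<close>, and any third sign vector leads
  back from one of the two.
\<close>

lemma signs_balance_two:
  fixes m f :: "'i \<Rightarrow> int"
  assumes "finite I" and "\<And>i. i \<in> I \<Longrightarrow> \<bar>m i\<bar> \<le> 1" and "\<And>i. i \<in> I \<Longrightarrow> \<bar>f i\<bar> \<le> 1"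
  obtains J where "J \<subseteq> I" "\<bar>sum m (I - J) - sum m J\<bar> \<le> 2" "\<bar>sum f (I - J) - sum f J\<bar> \<le> 1"
    "\<bar>(sum f (I - J) - sum f J) - (sum m (I - J) - sum m J)\<bar> \<le> 2"
proof -
  \<comment> \<open>The pairs of signed sums that can be reached; \<open>J\<close> collects the
    indices taken with a minus sign.\<close>
  define W where "W I = {(x, y). \<exists>J\<subseteq>I. x = sum m (I - J) - sum m J \<and> y = sum f (I - J) - sum f J}"
    for I
  have ins: "(x + \<epsilon> * m i, y + \<epsilon> * f i) \<in> W (insert i I)"
    if I: "finite I" "i \<notin> I" and xy: "(x, y) \<in> W I" and e: "\<epsilon> = 1 \<or> \<epsilon> = -1" for I i x y \<epsilon>
  proof -
    obtain J where J: "J \<subseteq> I" "x = sum m (I - J) - sum m J" "y = sum f (I - J) - sum f J"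
      using xy unfolding W_def by blast
    have fJ: "finite J" "i \<notin> J" using J I finite_subset by auto
    show ?thesis
    proof (cases "\<epsilon> = 1")
      case True
      have "insert i I - J = insert i (I - J)" using fJ by blast
      then show ?thesis
        using True J I by (auto simp: W_def intro!: exI[of _ J])
    next
      case False
      have "insert i I - insert i J = I - J" using I by blast
      then show ?thesis
        using False e J I fJ by (auto simp: W_def intro!: exI[of _ "insert i J"])
    qed
  qed
  have neg: "(-x, -y) \<in> W I" if xy: "(x, y) \<in> W I" for x y I
  proof -
    obtain J where J: "J \<subseteq> I" "x = sum m (I - J) - sum m J" "y = sum f (I - J) - sum f J"
      using xy unfolding W_def by blast
    have "I - (I - J) = J" using J(1) by blast
    then have "I - J \<subseteq> I \<and> -x = sum m (I - (I - J)) - sum m (I - J) \<and>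
        -y = sum f (I - (I - J)) - sum f (I - J)"
      using J by simp
    then show ?thesis unfolding W_def by blast
  qed
  have "(\<exists>x y. (x, y) \<in> W I \<and> \<bar>x\<bar> \<le> 1 \<and> \<bar>y\<bar> \<le> 1) \<or> ((2, 0) \<in> W I \<and> (0, 2) \<in> W I)"
    using assms
  proof (induction I rule: finite_induct)
    case empty
    then show ?case by (simp add: W_def)
  next
    case (insert i I)
    have mi: "m i = -1 \<or> m i = 0 \<or> m i = 1" and fi: "f i = -1 \<or> f i = 0 \<or> f i = 1"
      using insert.prems by (auto intro!: abs_le_1_cases)
    note step = ins[OF insert.hyps(1,2), of _ _ 1, simplified] ins[OF insert.hyps(1,2), of _ _ "-1", simplified]
    consider x y where "(x, y) \<in> W I" "\<bar>x\<bar> \<le> 1" "\<bar>y\<bar> \<le> 1" | "(2, 0) \<in> W I" "(0, 2) \<in> W I"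
      using insert by blast
    then show ?case
    proof cases
      case 1
      have xy: "x = -1 \<or> x = 0 \<or> x = 1" "y = -1 \<or> y = 0 \<or> y = 1"
        using 1 abs_le_1_cases by auto
      show ?thesis
      proof (cases "(\<bar>x + m i\<bar> \<le> 1 \<and> \<bar>y + f i\<bar> \<le> 1) \<or> (\<bar>x - m i\<bar> \<le> 1 \<and> \<bar>y - f i\<bar> \<le> 1)")
        case True
        then show ?thesis using step[OF 1(1)] by blast
      next
        case False
        \<comment> \<open>If neither the sum nor the difference is small, one fails in the first
          coordinate and the other in the second. All entries are then nonzero, and up to sign the
          two results are \<open>(2, 0)\<close> and \<open>(0, 2)\<close>.\<close>
        let ?N = "{(x + m i, y + f i), (x - m i, y - f i), (-(x + m i), -(y + f i)), (-(x - m i), -(y - f i))}"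
        have "?N \<subseteq> W (insert i I)"
          using step[OF 1(1)] neg[OF step(1)[OF 1(1)]] neg[OF step(2)[OF 1(1)]] by auto
        moreover have "(2, 0) \<in> ?N \<and> (0, 2) \<in> ?N"
          using False xy mi fi by (elim disjE) simp_all
        ultimately show ?thesis by blast
      qed
    next
      case 2
      have "(\<bar>2 + m i\<bar> \<le> 1 \<and> \<bar>0 + f i\<bar> \<le> 1) \<or> (\<bar>2 - m i\<bar> \<le> 1 \<and> \<bar>0 - f i\<bar> \<le> 1) \<or>
        (\<bar>0 + m i\<bar> \<le> 1 \<and> \<bar>2 + f i\<bar> \<le> 1) \<or> (\<bar>0 - m i\<bar> \<le> 1 \<and> \<bar>2 - f i\<bar> \<le> 1) \<or>
        (m i = 0 \<and> f i = 0)"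
        using mi fi by auto
      then show ?thesis
      proof (elim disjE conjE)
        assume "m i = 0" "f i = 0"
        then show ?thesis using step(1)[OF 2(1)] step(1)[OF 2(2)] by simp
      qed (use step[OF 2(1)] step[OF 2(2)] in blast)+
    qed
  qed
  \<comment> \<open>In the second alternative, \<open>(2, 0)\<close> meets all three bounds.\<close>
  then obtain x y where "(x, y) \<in> W I" "\<bar>x\<bar> \<le> 2" "\<bar>y\<bar> \<le> 1" "\<bar>y - x\<bar> \<le> 2"
    by force
  then show ?thesis
    using that by (auto simp: W_def)
qed

text \<open>The partner map is an involution on \<open>X\<close> that negates \<open>s\<close>, so
  reindexing turns the sum into its own negative.\<close>

lemma sum_pairing_zero:
  fixes s :: "'x \<Rightarrow> int"
  assumes "sym A" "single_valued A" "\<And>x. x \<in> X \<Longrightarrow> \<exists>y\<in>X. (x, y) \<in> A"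
    and "\<And>x y. (x, y) \<in> A \<Longrightarrow> s y = - s x"
  shows "sum s X = 0"
proof -
  define g where "g x = (SOME y. y \<in> X \<and> (x, y) \<in> A)" for x
  have g: "g x \<in> X \<and> (x, g x) \<in> A" if "x \<in> X" for x
    unfolding g_def by (rule someI_ex) (use assms(3)[OF that] in blast)
  have gg: "g (g x) = x" if "x \<in> X" for x
    using g[OF that] g[of "g x"] assms(1,2) by (meson single_valuedD symD)
  have "sum s X = (\<Sum>x\<in>X. - s x)"
    by (rule sum.reindex_bij_witness[of _ g g]) (use g gg assms(4) in force)+
  then show ?thesis by (simp add: sum_negf)
qed

text \<open>
  \<open>C\<close> is connected by the links in \<open>A\<close> and \<open>B\<close>, hence has at least \<open>card C - 1\<close> of them;
  every link accounts for two of the \<open>2 * card C\<close> places where an element could have a link.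
\<close>

lemma card_unlinked_le_2:
  assumes fin: "finite C" and "C \<noteq> {}"
    and A: "sym A" "single_valued A" "A `` C \<subseteq> C"
    and B: "sym B" "single_valued B" "B `` C \<subseteq> C"
    and min: "\<And>T. T \<subseteq> C \<Longrightarrow> T \<noteq> {} \<Longrightarrow> A `` T \<subseteq> T \<Longrightarrow> B `` T \<subseteq> T \<Longrightarrow> T = C"
  shows "card (C - Domain A) + card (C - Domain B) \<le> 2"
proof -
  define I where "I D T = card {x\<in>T. \<exists>y\<in>T. (x, y) \<in> D}" for D :: "('a \<times> 'a) set" and T
  have mono: "I D T \<le> I D (insert y T)" if "T \<subseteq> C" for D T y
    using that finite_subset[OF that fin] unfolding I_def by (intro card_mono) auto
  have grow: "I D T + 2 \<le> I D (insert y T)"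
    if D: "sym D" "single_valued D" and T: "T \<subseteq> C" "x \<in> T" "y \<notin> T" "(x, y) \<in> D" for D T x y
  proof -
    have fT: "finite T" using T fin finite_subset by blast
    \<comment> \<open>Both \<open>x\<close> and \<open>y\<close> are newly counted: the only partner
      of \<open>x\<close> is \<open>y\<close>, which lies outside \<open>T\<close>.\<close>
    have "I D T + 2 = card (insert x (insert y {x\<in>T. \<exists>y\<in>T. (x, y) \<in> D}))"
      using fT T D by (subst card_insert_disjoint | auto simp: I_def dest: single_valuedD)+
    also have "\<dots> \<le> I D (insert y T)"
      unfolding I_def using fT T D by (intro card_mono) (auto dest: symD)
    finally show ?thesis .
  qed
  \<comment> \<open>The tree bound, with each link counted at both ends. A singleton satisfies it,
    and following a link out of \<open>T\<close> preserves it, so a maximal such set is closed and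
    equals \<open>C\<close>.\<close>
  define ok where "ok T \<longleftrightarrow> T \<subseteq> C \<and> T \<noteq> {} \<and> 2 * card T \<le> I A T + I B T + 2" for T
  obtain x where "x \<in> C" using assms(2) by blast
  then have "ok {x}" by (auto simp: ok_def)
  moreover have "finite {T. ok T}"
    using fin by (rule_tac finite_subset[of _ "Pow C"]) (auto simp: ok_def)
  ultimately obtain T where T: "ok T" and max: "\<And>T'. ok T' \<Longrightarrow> T \<subseteq> T' \<Longrightarrow> T' = T"
    using finite_has_maximal[of "{T. ok T}"] by auto
  have TC: "T \<subseteq> C" "T \<noteq> {}" "finite T"
    using T fin finite_subset by (auto simp: ok_def)
  have stuck: "y \<in> T" if "x \<in> T" "(x, y) \<in> A \<union> B" for x y
  proof (rule ccontr)
    assume y: "y \<notin> T"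
    have "I A T + I B T + 2 \<le> I A (insert y T) + I B (insert y T)"
      using that y grow[OF A(1,2) TC(1)] grow[OF B(1,2) TC(1)] mono[OF TC(1)]
      by (metis Un_iff add.commute add.left_commute add_mono)
    moreover have "y \<in> C" using that A(3) B(3) TC(1) by blast
    ultimately have "ok (insert y T)"
      using T y TC(3) by (auto simp: ok_def)
    then show False using max y by blast
  qed
  have "T = C"
    by (rule min) (use TC stuck in auto)
  then have "2 * card C \<le> I A C + I B C + 2"
    using T by (simp add: ok_def)
  moreover have split: "I D C + card (C - Domain D) = card C" if "D `` C \<subseteq> C" for D
  proof -
    have "{x\<in>C. \<exists>y\<in>C. (x, y) \<in> D} = C \<inter> Domain D" using that by blast
    then show ?thesis
      unfolding I_def using fin card_Int_Diff by metis
  qed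
  note split[OF A(3)] split[OF B(3)]
  ultimately show ?thesis by linarith
qed

text \<open>\<open>A\<close> will consist of the matching ties and \<open>B\<close> of the ties
  between chosen roots. On each component let \<open>r\<close> be the signed number of slots and
  \<open>2 * m\<close> that of the slots in \<open>Domain A\<close>. Then \<open>m\<close> and
  \<open>m - r\<close> lie in \<open>{-1, 0, 1}\<close>, and \<open>signs_balance_two\<close>
  selects the components to exchange. The combination \<open>m - r\<close> measures forest sizes,
  since every additional root costs an arc.\<close>

lemma balanced_swap:
  fixes S :: "'x set" and s :: "'x \<Rightarrow> int"
  assumes fin: "finite S"
    and A: "A \<subseteq> S \<times> S" "sym A" "single_valued A"
    and B: "B \<subseteq> S \<times> S" "sym B" "single_valued B"
    and s: "\<And>x. \<bar>s x\<bar> \<le> 1" and flip: "\<And>x y. (x, y) \<in> B \<Longrightarrow> s y = - s x"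
    and ev: "\<And>X. X \<subseteq> S \<Longrightarrow> A `` X \<subseteq> X \<Longrightarrow> even (sum s (X \<inter> Domain A))"
  obtains X where "X \<subseteq> S" "A `` X \<subseteq> X" "B `` X \<subseteq> X"
    "\<bar>sum s (S - X) - sum s X\<bar> \<le> 2"
    "\<bar>sum s ((S - X) \<inter> Domain A) - sum s (X \<inter> Domain A)\<bar> \<le> 4"
    "\<bar>(sum s ((S - X) \<inter> Domain A) - sum s (X \<inter> Domain A)) - 2 * (sum s (S - X) - sum s X)\<bar> \<le> 2"
proof -
  define closed where "closed X \<longleftrightarrow> X \<subseteq> S \<and> A `` X \<subseteq> X \<and> B `` X \<subseteq> X" for X
  \<comment> \<open>These are the connected components of the link graph, obtained as minimal
    nonempty closed sets.\<close>
  define atom where "atom C \<longleftrightarrow> closed C \<and> C \<noteq> {} \<and> (\<forall>T. closed T \<longrightarrow> T \<noteq> {} \<longrightarrow> T \<subseteq> C \<longrightarrow> T = C)" for C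
  define P where "P = {C. atom C}"
  have finP: "finite P"
    using fin by (rule_tac finite_subset[of _ "Pow S"]) (auto simp: P_def atom_def closed_def)
  have disj: "C \<inter> D = {}" if "C \<in> P" "D \<in> P" "C \<noteq> D" for C D
  proof (rule ccontr)
    assume ne: "C \<inter> D \<noteq> {}"
    have "closed (C \<inter> D)"
      using that by (auto simp: P_def atom_def closed_def)
    then have "C \<inter> D = C" "C \<inter> D = D"
      using that ne by (auto simp: P_def atom_def)
    then show False using that by blast
  qed
  have finC: "finite C" if "C \<in> P" for C
    using that fin finite_subset by (auto simp: P_def atom_def closed_def)
  have compl: "closed (S - X)" if "closed X" for X
    using that A(1,2) B(1,2) unfolding closed_def sym_def by blast
  have clU: "closed (\<Union>J)" if "J \<subseteq> P" for J
  proof -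
    have "closed C" if "C \<in> J" for C
      using that \<open>J \<subseteq> P\<close> by (auto simp: P_def atom_def)
    then show ?thesis
      unfolding closed_def by blast
  qed
  have UP: "\<Union>P = S"
  proof (rule ccontr)
    assume "\<Union>P \<noteq> S"
    moreover have "\<Union>P \<subseteq> S" by (auto simp: P_def atom_def closed_def)
    ultimately have ne: "S - \<Union>P \<noteq> {}" by blast
    obtain C where C: "C \<subseteq> S - \<Union>P" "closed C \<and> C \<noteq> {}"
      "\<And>T. T \<subseteq> C \<Longrightarrow> closed T \<and> T \<noteq> {} \<Longrightarrow> T = C"
      using minimal_subset[of "S - \<Union>P" "\<lambda>T. closed T \<and> T \<noteq> {}"] fin ne compl[OF clU]
      by (metis finite_Diff order_refl)
    have "atom C" unfolding atom_def using C by auto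
    then show False using C by (auto simp: P_def)
  qed
  define r where "r C = sum s C" for C
  define m where "m C = sum s (C \<inter> Domain A) div 2" for C
  have m2: "2 * m C = sum s (C \<inter> Domain A)" if "C \<in> P" for C
    unfolding m_def using ev[of C] that by (auto simp: P_def atom_def closed_def)
  have bound: "\<bar>m C\<bar> \<le> 1 \<and> \<bar>m C - r C\<bar> \<le> 1" if C: "C \<in> P" for C
  proof -
    have cl: "C \<subseteq> S" "C \<noteq> {}" "A `` C \<subseteq> C" "B `` C \<subseteq> C"
      using C by (auto simp: P_def atom_def closed_def)
    have unlinked: "card (C - Domain A) + card (C - Domain B) \<le> 2"
      using C cl A B finC[OF C]
      by (intro card_unlinked_le_2) (auto simp: P_def atom_def closed_def)
    have abs_card: "\<bar>sum s X\<bar> \<le> int (card X)" for X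
      by (rule order_trans[OF sum_abs]) (use sum_bounded_above[of X "\<lambda>x. \<bar>s x\<bar>" 1, OF s] in simp)
    have split: "sum s C = sum s (C \<inter> Domain D) + sum s (C - Domain D)" for D
      using finC[OF C] by (rule sum.Int_Diff)
    have zero: "sum s (C \<inter> Domain B) = 0"
      using B cl(4) flip by (intro sum_pairing_zero[of B]) (auto simp: sym_def, blast)
    \<comment> \<open>Partners under \<open>B\<close> cancel, so \<open>r C\<close> is a sum over
      \<open>C - Domain B\<close>, while \<open>r C - 2 * m C\<close> is the sum over
      \<open>C - Domain A\<close>. Up to sign, the difference and the sum of these two numbers are
      \<open>2 * m C\<close> and \<open>2 * (m C - r C)\<close>.\<close>
    have "\<bar>r C\<bar> + \<bar>r C - 2 * m C\<bar> \<le> 2"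
      using unlinked abs_card[of "C - Domain A"] abs_card[of "C - Domain B"]
        m2[OF C] split[of A] split[of B] zero unfolding r_def by linarith
    then show ?thesis by arith
  qed
  obtain J where J: "J \<subseteq> P" "\<bar>sum m (P - J) - sum m J\<bar> \<le> 2"
    "\<bar>sum (\<lambda>C. m C - r C) (P - J) - sum (\<lambda>C. m C - r C) J\<bar> \<le> 1"
    "\<bar>(sum (\<lambda>C. m C - r C) (P - J) - sum (\<lambda>C. m C - r C) J) - (sum m (P - J) - sum m J)\<bar> \<le> 2"
    by (rule signs_balance_two[OF finP, of m "\<lambda>C. m C - r C"]) (use bound in auto)
  have sumr: "sum s (\<Union>Q) = sum r Q" if "Q \<subseteq> P" for Q
  proof -
    have "\<forall>C\<in>Q. finite C" "\<forall>C\<in>Q. \<forall>D\<in>Q. C \<noteq> D \<longrightarrow> C \<inter> D = {}"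
      using that finC disj by blast+
    then show ?thesis
      unfolding r_def by (simp add: sum.Union_disjoint)
  qed
  have summ: "sum s (\<Union>Q \<inter> Domain A) = 2 * sum m Q" if "Q \<subseteq> P" for Q
  proof -
    have "\<Union>Q \<inter> Domain A = (\<Union>C\<in>Q. C \<inter> Domain A)" by blast
    also have "sum s \<dots> = (\<Sum>C\<in>Q. sum s (C \<inter> Domain A))"
    proof (rule sum.UNION_disjoint)
      show "finite Q" using that finP by (rule finite_subset)
      show "\<forall>C\<in>Q. finite (C \<inter> Domain A)" using that finC by blast
      show "\<forall>C\<in>Q. \<forall>D\<in>Q. C \<noteq> D \<longrightarrow> C \<inter> Domain A \<inter> (D \<inter> Domain A) = {}"
        using that disj by blast
    qed
    also have "\<dots> = (\<Sum>C\<in>Q. 2 * m C)"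
      by (rule sum.cong) (use that m2 in auto)
    finally show ?thesis by (simp add: sum_distrib_left)
  qed
  have diff: "S - \<Union>J = \<Union>(P - J)"
    using UP disj J(1) by blast
  have "closed (\<Union>J)" using clU J(1) .
  then show ?thesis
    using that[of "\<Union>J"] J sumr[of J] sumr[of "P - J"] summ[of J] summ[of "P - J"]
    unfolding closed_def diff by (auto simp: sum_subtractf)
qed

subsection \<open>Matching forests as matchings and branchings\<close>

text \<open>An orbit in a finite set repeats itself. Taking \<open>n\<close> least among the periods
  of all points of \<open>U\<close> excludes an earlier repetition, which would give some point a
  shorter period.\<close>

lemma periodic_point:
  assumes fin: "finite U" and "U \<noteq> {}" and p: "p ` U \<subseteq> U"
  obtains n x where "0 < n" "x \<in> U" "(p ^^ n) x = x" "inj_on (\<lambda>i. (p ^^ i) x) {..<n}"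
proof -
  have pU: "(p ^^ i) x \<in> U" if "x \<in> U" for i x
    using that p by (induction i) auto
  have shift: "(p ^^ (j - i)) ((p ^^ i) x) = (p ^^ i) x" if "i < j" "(p ^^ i) x = (p ^^ j) x" for i j x
  proof -
    have "(p ^^ (j - i)) ((p ^^ i) x) = (p ^^ (j - i + i)) x" by (simp add: funpow_add)
    then show ?thesis using that by simp
  qed
  obtain x0 where x0: "x0 \<in> U" using assms(2) by blast
  have "\<not> inj (\<lambda>i. (p ^^ i) x0)"
    using pU[OF x0] finite_subset[OF _ fin, of "range (\<lambda>i. (p ^^ i) x0)"]
    by (metis finite_imageD image_subsetI infinite_UNIV_nat)
  then obtain i j where "i < j" "(p ^^ i) x0 = (p ^^ j) x0"
    unfolding inj_def by (metis linorder_neqE_nat)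
  then have "\<exists>n>0. \<exists>x\<in>U. (p ^^ n) x = x"
    using shift pU[OF x0] by (metis zero_less_diff)
  then obtain n where n: "0 < n" "\<exists>x\<in>U. (p ^^ n) x = x"
    and least: "\<And>k. k < n \<Longrightarrow> \<not> (0 < k \<and> (\<exists>x\<in>U. (p ^^ k) x = x))"
    using exists_least_iff[of "\<lambda>n. 0 < n \<and> (\<exists>x\<in>U. (p ^^ n) x = x)"] by metis
  obtain x where x: "x \<in> U" "(p ^^ n) x = x" using n by blast
  have neq: "(p ^^ i) x \<noteq> (p ^^ j) x" if "i < j" "j < n" for i j
  proof
    assume "(p ^^ i) x = (p ^^ j) x"
    then have "(p ^^ (j - i)) ((p ^^ i) x) = (p ^^ i) x"
      using shift that(1) by blast
    then show False
      using least[of "j - i"] that pU[OF x(1)] by auto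
  qed
  have "inj_on (\<lambda>i. (p ^^ i) x) {..<n}"
  proof (rule inj_onI)
    fix i j assume "i \<in> {..<n}" "j \<in> {..<n}" "(p ^^ i) x = (p ^^ j) x"
    then show "i = j"
      using neq[of i j] neq[of j i] by (cases i j rule: linorder_cases) auto
  qed
  then show ?thesis using that n(1) x by blast
qed

context mixed_graph
begin

lemma arc_not_edge: "a \<in> arcs G \<Longrightarrow> a \<notin> edges G"
  using edges_arcs_disjoint by blast

lemma underlying_ends_subset: "e \<in> edges G \<union> arcs G \<Longrightarrow> underlying_ends G e \<subseteq> verts G"
  using ends_subset tail_in_verts head_in_verts by (auto simp: underlying_ends_def)

lemma heads_subset: "heads G e \<subseteq> underlying_ends G e"
  by (simp add: heads_def underlying_ends_def)

text \<open>In a set \<open>U\<close> that contains no root and is entered by no arc, every vertex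
  has an entering arc whose tail is again in \<open>U\<close>. Walking backwards along these arcs
  becomes periodic and traces a cycle.\<close>

lemma spanning_if_no_cycle:
  assumes B: "B \<subseteq> arcs G" and nc: "\<nexists>vs es. is_cycle G vs es \<and> set es \<subseteq> B"
  shows "spanning (tail G) (head G) (verts G) (verts G - head G ` B) B"
  unfolding spanning_def
proof (intro allI impI, rule ccontr)
  fix U assume U: "U \<subseteq> verts G" "U \<noteq> {}" "U \<inter> (verts G - head G ` B) = {}"
    and ne: "\<not> (\<exists>a\<in>B. enters (tail G) (head G) U a)"
  define a where "a v = (SOME a. a \<in> B \<and> head G a = v)" for v
  have a: "a v \<in> B \<and> head G (a v) = v" if "v \<in> U" for v
    unfolding a_def by (rule someI_ex) (use U that in blast)
  define p where "p v = tail G (a v)" for v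
  have p: "p ` U \<subseteq> U"
    using a ne by (force simp: p_def enters_def)
  have "finite U" using U(1) finite_verts by (rule finite_subset)
  from periodic_point[OF this U(2) p] obtain n x where
    n: "0 < n" "x \<in> U" "(p ^^ n) x = x" "inj_on (\<lambda>i. (p ^^ i) x) {..<n}" .
  have pU: "(p ^^ i) x \<in> U" for i
    using n(2) p by (induction i) auto
  let ?vs = "map (\<lambda>i. (p ^^ i) x) [0..<n]" and ?es = "map (\<lambda>i. a ((p ^^ i) x)) [0..<n]"
  have inj_a: "inj_on a U"
    using a by (metis inj_onI)
  have "distinct ?vs"
    using n(4) by (simp add: distinct_map atLeast0LessThan)
  moreover have "distinct ?es"
    using comp_inj_on[OF n(4), of a] inj_on_subset[OF inj_a] pU
    by (simp add: distinct_map atLeast0LessThan comp_def image_subset_iff)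
  moreover have "underlying_ends G (?es ! i) = {?vs ! i, ?vs ! (Suc i mod n)}" if "i < n" for i
  proof -
    have "?vs ! (Suc i mod n) = p ((p ^^ i) x)"
    proof (cases "Suc i = n")
      case True
      have "p ((p ^^ i) x) = (p ^^ n) x" by (simp flip: True)
      then show ?thesis using n(1,3) True by simp
    next
      case False
      then show ?thesis using that by simp
    qed
    moreover have "a ((p ^^ i) x) \<notin> edges G"
      using a[OF pU] B arc_not_edge by blast
    ultimately show ?thesis
      using that a[OF pU] by (auto simp: underlying_ends_def p_def)
  qed
  ultimately have "is_cycle G ?vs ?es"
    using n(1) by (simp add: is_cycle_def)
  moreover have "set ?es \<subseteq> B"
    using a pU by auto
  ultimately show False using nc by blast
qed

text \<open>
  A cycle has as many vertices as elements, and each element covers at least one of these vertices;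
  so it consists of arcs, and no arc enters its vertex set.
\<close>

lemma no_cycle_if_spanning:
  assumes F: "F \<subseteq> edges G \<union> arcs G"
    and cov: "\<forall>v\<in>verts G. \<forall>e\<in>F. \<forall>f\<in>F. v \<in> heads G e \<longrightarrow> v \<in> heads G f \<longrightarrow> e = f"
    and span: "spanning (tail G) (head G) (verts G) (verts G - head G ` (F \<inter> arcs G)) (F \<inter> arcs G)"
    and cyc: "is_cycle G vs es" "set es \<subseteq> F"
  shows False
proof -
  have c: "es \<noteq> []" "length vs = length es" "distinct vs" "distinct es"
    "\<And>i. i < length es \<Longrightarrow> underlying_ends G (es ! i) = {vs ! i, vs ! (Suc i mod length es)}"
    using cyc(1) by (auto simp: is_cycle_def)
  have ue: "underlying_ends G e \<subseteq> set vs" if e: "e \<in> set es" for e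
  proof -
    obtain i where i: "i < length es" "e = es ! i"
      using e by (metis in_set_conv_nth)
    moreover have "Suc i mod length es < length es"
      using c(1) by simp
    ultimately show ?thesis using c(5)[OF i(1)] c(2) by simp
  qed
  have vsV: "set vs \<subseteq> verts G"
  proof
    fix v assume "v \<in> set vs"
    then obtain i where i: "i < length es" "v = vs ! i"
      using c(2) by (metis in_set_conv_nth)
    then have "v \<in> underlying_ends G (es ! i)" using c(5)[OF i(1)] by simp
    moreover have "es ! i \<in> edges G \<union> arcs G"
      using i cyc(2) F nth_mem by blast
    ultimately show "v \<in> verts G"
      using underlying_ends_subset by blast
  qed
  define g where "g e = (SOME v. v \<in> heads G e)" for e
  have g: "g e \<in> heads G e" if "e \<in> set es" for e
  proof -
    have "heads G e \<noteq> {}"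
      using card_ends[of e] by (auto simp: heads_def)
    then show ?thesis
      unfolding g_def by (simp add: some_in_eq)
  qed
  have gv: "g e \<in> set vs" if "e \<in> set es" for e
    using g[OF that] heads_subset ue[OF that] by blast
  have uniq: "e = f" if "e \<in> set es" "f \<in> F" "v \<in> heads G e" "v \<in> heads G f" "v \<in> set vs" for e f v
    using cov that cyc(2) vsV by blast
  have "inj_on g (set es)"
  proof (rule inj_onI)
    fix e f assume "e \<in> set es" "f \<in> set es" "g e = g f"
    then show "e = f"
      using uniq[of e f "g e"] g[of e] g[of f] gv[of e] cyc(2) by auto
  qed
  then have "card (g ` set es) = card (set vs)"
    using c(2-4) by (simp add: card_image distinct_card)
  then have surj: "g ` set es = set vs"
    using gv by (intro card_subset_eq) auto
  \<comment> \<open>By counting, \<open>g\<close> is a bijection from the elements of the cycle to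
    its vertices. An edge would cover two of these vertices, and by uniqueness both would be its
    value under \<open>g\<close>.\<close>
  have head_g: "e \<in> arcs G \<and> head G e = g e" if e: "e \<in> set es" for e
  proof -
    have "e \<notin> edges G"
    proof
      assume "e \<in> edges G"
      then obtain u w where uw: "ends G e = {u, w}" "u \<noteq> w"
        using card_ends by (meson card_2_iff)
      then have h: "u \<in> heads G e" "w \<in> heads G e"
        using \<open>e \<in> edges G\<close> by (auto simp: heads_def)
      then have "u \<in> set vs" "w \<in> set vs"
        using heads_subset ue[OF e] by blast+
      then obtain e1 e2 where "e1 \<in> set es" "e2 \<in> set es" "u = g e1" "w = g e2"
        using surj by (metis imageE)
      then have "e = e1" "e = e2"
        using uniq[OF e] h g gv cyc(2) by blast+
      then show False using \<open>u = g e1\<close> \<open>w = g e2\<close> uw by simp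
    qed
    then show ?thesis
      using e F cyc(2) g[OF e] by (auto simp: heads_def)
  qed
  have "set vs \<noteq> {}" using c(1,2) by auto
  moreover have "set vs \<subseteq> head G ` (F \<inter> arcs G)"
  proof
    fix v assume "v \<in> set vs"
    then obtain e where "e \<in> set es" "v = g e"
      using surj by (metis imageE)
    then show "v \<in> head G ` (F \<inter> arcs G)"
      using head_g[of e] cyc(2) by (intro image_eqI[of _ _ e]) auto
  qed
  then have "set vs \<inter> (verts G - head G ` (F \<inter> arcs G)) = {}" by blast
  \<comment> \<open>The vertices of the cycle are not roots, so some arc \<open>b\<close> must enter
    them; but its head is already covered by an element of the cycle, whose tail lies on the
    cycle.\<close>
  ultimately obtain b where b: "b \<in> F \<inter> arcs G" "enters (tail G) (head G) (set vs) b"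
    using spanningD[OF span vsV] by blast
  then obtain e where e: "e \<in> set es" "g e = head G b"
    using surj by (metis enters_def imageE)
  moreover have "head G b \<in> heads G b"
    using b(1) arc_not_edge by (auto simp: heads_def)
  ultimately have "e = b"
    using uniq[OF e(1), of b "g e"] b(1) g[OF e(1)] gv[OF e(1)] e(2) by simp
  then have "tail G b \<in> set vs"
    using ue[OF e(1)] b(1) arc_not_edge by (auto simp: underlying_ends_def)
  then show False
    using b(2) by (simp add: enters_def)
qed

lemma covered_once_iff:
  assumes F: "F \<subseteq> edges G \<union> arcs G"
  shows "(\<forall>v\<in>verts G. \<forall>e\<in>F. \<forall>f\<in>F. v \<in> heads G e \<longrightarrow> v \<in> heads G f \<longrightarrow> e = f) \<longleftrightarrow>
    (\<forall>e\<in>F \<inter> edges G. ends G e \<inter> head G ` (F \<inter> arcs G) = {}) \<and>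
    (\<forall>e\<in>F \<inter> edges G. \<forall>f\<in>F \<inter> edges G. ends G e \<inter> ends G f \<noteq> {} \<longrightarrow> e = f) \<and>
    inj_on (head G) (F \<inter> arcs G)" (is "?L \<longleftrightarrow> ?E \<and> ?M \<and> ?I")
proof
  assume L: ?L
  have hE: "heads G e = ends G e" "ends G e \<subseteq> verts G" if "e \<in> edges G" for e
    using that ends_subset by (auto simp: heads_def)
  have hA: "heads G a = {head G a}" "head G a \<in> verts G" if "a \<in> arcs G" for a
    using that arc_not_edge head_in_verts by (auto simp: heads_def)
  have ?E
  proof (intro ballI equals0I)
    fix e v assume "e \<in> F \<inter> edges G" "v \<in> ends G e \<inter> head G ` (F \<inter> arcs G)"
    then obtain a where a: "a \<in> F \<inter> arcs G" "v = head G a" "v \<in> ends G e" "e \<in> F \<inter> edges G"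
      by blast
    then have "e = a" using L hE[of e] hA[of a] by blast
    then show False using a arc_not_edge by blast
  qed
  moreover have ?M
  proof (intro ballI impI)
    fix e f assume ef: "e \<in> F \<inter> edges G" "f \<in> F \<inter> edges G" "ends G e \<inter> ends G f \<noteq> {}"
    then show "e = f" using L hE[of e] hE[of f] by blast
  qed
  moreover have ?I
  proof (rule inj_onI)
    fix e f assume ef: "e \<in> F \<inter> arcs G" "f \<in> F \<inter> arcs G" "head G e = head G f"
    then show "e = f" using L hA[of e] hA[of f] by auto
  qed
  ultimately show "?E \<and> ?M \<and> ?I" by blast
next
  assume R: "?E \<and> ?M \<and> ?I"
  show ?L
  proof (intro ballI impI)
    fix v e f assume ef: "e \<in> F" "f \<in> F" "v \<in> heads G e" "v \<in> heads G f"
    have sp: "(x \<in> edges G \<and> v \<in> ends G x) \<or> (x \<in> arcs G \<and> v = head G x)"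
      if "x \<in> F" "v \<in> heads G x" for x
      using that F by (auto simp: heads_def split: if_splits)
    show "e = f"
      using sp[OF ef(1,3)] sp[OF ef(2,4)]
    proof (elim disjE conjE)
      assume "e \<in> edges G" "v \<in> ends G e" "f \<in> edges G" "v \<in> ends G f"
      then show ?thesis using R ef by blast
    next
      assume "e \<in> edges G" "v \<in> ends G e" "f \<in> arcs G" "v = head G f"
      then show ?thesis using R ef by blast
    next
      assume "e \<in> arcs G" "v = head G e" "f \<in> edges G" "v \<in> ends G f"
      then show ?thesis using R ef by blast
    next
      assume "e \<in> arcs G" "v = head G e" "f \<in> arcs G" "v = head G f"
      then show ?thesis using R ef by (auto dest: inj_onD)
    qed
  qed
qed

text \<open>Cycles disappear from here on: a matching forest is a matching together with a branching
  whose roots include all ends of matching edges.\<close>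

lemma matching_forest_iff:
  "matching_forest G F \<longleftrightarrow> F \<subseteq> edges G \<union> arcs G \<and>
    (\<forall>e\<in>F \<inter> edges G. ends G e \<inter> head G ` (F \<inter> arcs G) = {}) \<and>
    (\<forall>e\<in>F \<inter> edges G. \<forall>f\<in>F \<inter> edges G. ends G e \<inter> ends G f \<noteq> {} \<longrightarrow> e = f) \<and>
    branching (tail G) (head G) (verts G) (verts G - head G ` (F \<inter> arcs G)) (F \<inter> arcs G)"
proof -
  have hV: "verts G - (verts G - head G ` (F \<inter> arcs G)) = head G ` (F \<inter> arcs G)"
    using head_in_verts by blast
  show ?thesis
  proof (cases "F \<subseteq> edges G \<union> arcs G")
    case True
    \<comment> \<open>Acyclicity and the cut condition need to agree only under the covering
      condition.\<close>
    have logic: "(X \<and> N \<and> A) = (X \<and> E \<and> M \<and> I \<and> H \<and> S)"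
      if X H "A = (E \<and> M \<and> I)" "A \<Longrightarrow> N = S" for X N A E M I H S
      using that by blast
    show ?thesis
      unfolding matching_forest_def branching_def
    proof (rule logic[OF True hV[symmetric] covered_once_iff[OF True]])
      assume cov: "\<forall>v\<in>verts G. \<forall>e\<in>F. \<forall>f\<in>F. v \<in> heads G e \<longrightarrow> v \<in> heads G f \<longrightarrow> e = f"
      show "(\<nexists>vs es. is_cycle G vs es \<and> set es \<subseteq> F) =
        spanning (tail G) (head G) (verts G) (verts G - head G ` (F \<inter> arcs G)) (F \<inter> arcs G)"
      proof
        assume "\<nexists>vs es. is_cycle G vs es \<and> set es \<subseteq> F"
        then show "spanning (tail G) (head G) (verts G) (verts G - head G ` (F \<inter> arcs G)) (F \<inter> arcs G)"
          by (intro spanning_if_no_cycle) auto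
      qed (use no_cycle_if_spanning[OF True cov] in blast)
    qed
  qed (simp add: matching_forest_def)
qed

end

subsection \<open>Rebalancing\<close>

lemma card_2_other: "card X = 2 \<Longrightarrow> v \<in> X \<Longrightarrow> \<exists>u. X = {v, u} \<and> v \<noteq> u"
  by (auto simp: card_2_iff)

context mixed_graph
begin

text \<open>
  Swap structure for two disjoint matching forests, indexed by \<open>bool\<close>. A slot \<open>(v, i)\<close> says that
  \<open>v\<close> is a root of the branching in \<open>F i\<close>. Two slots are linked if an edge of \<open>F i\<close> joins them, or
  if they are the chosen roots of the two branchings in one minimal set that no arc enters. Any set
  of slots closed under links may change sides.
\<close>

lemma rebalance_two:
  fixes F :: "bool \<Rightarrow> 'e set"
  assumes mf: "\<And>i. matching_forest G (F i)" and disj: "F True \<inter> F False = {}"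
  obtains F' :: "bool \<Rightarrow> 'e set" where
    "\<And>i. matching_forest G (F' i)" "F' True \<inter> F' False = {}"
    "F' True \<union> F' False = F True \<union> F False"
    "\<bar>int (card (F' True)) - int (card (F' False))\<bar> \<le> 1"
    "\<bar>int (card (F' True \<inter> edges G)) - int (card (F' False \<inter> edges G))\<bar> \<le> 2"
    "\<bar>int (card (F' True \<inter> arcs G)) - int (card (F' False \<inter> arcs G))\<bar> \<le> 2"
proof -
  let ?t = "tail G" and ?h = "head G" and ?V = "verts G"
  define M where "M i = F i \<inter> edges G" for i
  define B where "B i = F i \<inter> arcs G" for i
  define R where "R i = ?V - ?h ` B i" for i
  define D where "D = B True \<union> B False"
  have F: "F i = M i \<union> B i" for i
    using mf[of i] by (auto simp: M_def B_def matching_forest_def)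
  have Medge: "e \<in> edges G" if "e \<in> M i" for e i
    using that by (simp add: M_def)
  have Mends: "ends G e \<inter> ?h ` B i = {}" if "e \<in> M i" for e i
    using mf[of i] that unfolding matching_forest_iff M_def B_def by blast
  have Mmatch: "e = f" if "e \<in> M i" "f \<in> M i" "v \<in> ends G e" "v \<in> ends G f" for e f v i
    using mf[of i] that unfolding matching_forest_iff M_def by blast
  have Bbr: "branching ?t ?h ?V (R i) (B i)" for i
    using mf[of i] unfolding matching_forest_iff R_def B_def by blast
  have finM: "finite (M i)" and finB: "finite (B i)" for i
    using finite_matching_forest[OF mf[of i]] by (auto simp: M_def B_def)
  have disjM: "M True \<inter> M False = {}" and disjB: "B True \<inter> B False = {}"
    using disj by (auto simp: M_def B_def)
  have disjMi: "M i \<inter> M (\<not> i) = {}" for i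
    using disjM by (cases i) auto
  have RV: "R i \<subseteq> ?V" for i by (auto simp: R_def)
  have MR: "ends G e \<subseteq> R i" if "e \<in> M i" for e i
    using Mends[OF that] ends_subset[OF Medge[OF that]] by (auto simp: R_def)
  have DA: "D \<subseteq> arcs G" by (auto simp: D_def B_def)
  have BD: "B i \<subseteq> D" for i by (cases i) (auto simp: D_def)

  \<comment> \<open>Source components and their chosen roots\<close>
  define src where "src K \<longleftrightarrow> K \<subseteq> ?V \<and> K \<noteq> {} \<and> (\<forall>a\<in>D. \<not> enters ?t ?h K a)" for K
  \<comment> \<open>These are the strong components of the digraph with arc set \<open>D\<close>
    that no arc enters.\<close>
  define atom where "atom K \<longleftrightarrow> src K \<and> (\<forall>L. L \<subseteq> K \<longrightarrow> src L \<longrightarrow> L = K)" for K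
  have atom_disj: "K = L" if "atom K" "atom L" "v \<in> K" "v \<in> L" for K L v
  proof -
    have "src (K \<inter> L)"
      using that by (auto simp: atom_def src_def enters_def)
    then have "K \<inter> L = K" "K \<inter> L = L"
      using that(1,2) unfolding atom_def by blast+
    then show ?thesis by simp
  qed
  \<comment> \<open>A root of branching \<open>i\<close> in \<open>K\<close> exists because no arc
    of \<open>B i\<close> enters \<open>K\<close>.\<close>
  define \<rho> where "\<rho> K i = (SOME v. v \<in> K \<inter> R i)" for K i
  have \<rho>: "\<rho> K i \<in> K \<and> \<rho> K i \<in> R i" if K: "atom K" for K i
  proof -
    have "K \<inter> R i \<noteq> {}"
    proof
      assume "K \<inter> R i = {}"
      then obtain a where "a \<in> B i" "enters ?t ?h K a"
        using Bbr[of i] K spanningD[of ?t ?h ?V "R i" "B i" K]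
        by (auto simp: branching_def atom_def src_def)
      then show False using K BD by (auto simp: atom_def src_def)
    qed
    then have "\<exists>v. v \<in> K \<inter> R i" by blast
    from someI_ex[OF this] show ?thesis
      unfolding \<rho>_def by blast
  qed

  \<comment> \<open>Slots and their links\<close>
  define S where "S = {(v, i). v \<in> R i}"
  define P where "P = {((u, i), (v, i)) | u v i. \<exists>e\<in>M i. ends G e = {u, v} \<and> u \<noteq> v}"
  define N where "N = {((\<rho> K i, i), (\<rho> K (\<not> i), \<not> i)) | K i. atom K}"
  define s where "s x = (if snd x then 1 else - 1 :: int)" for x :: "'v \<times> bool"
  have "S \<subseteq> ?V \<times> UNIV" using RV by (auto simp: S_def)
  then have finS: "finite S"
    using finite_verts finite_subset by fastforce
  have PS: "P \<subseteq> S \<times> S"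
    using MR by (fastforce simp: P_def S_def)
  have symP: "sym P"
    unfolding sym_def P_def by (auto simp: insert_commute)
  have svP: "single_valued P"
  proof (rule single_valuedI)
    fix x y z assume "(x, y) \<in> P" "(x, z) \<in> P"
    then obtain u v w i e f where x: "x = (u, i)" "y = (v, i)" "z = (w, i)"
      and e: "e \<in> M i" "ends G e = {u, v}" "u \<noteq> v" and f: "f \<in> M i" "ends G f = {u, w}" "u \<noteq> w"
      by (auto simp: P_def)
    then have "e = f" using Mmatch[of e i f u] by auto
    then show "y = z" using x e f by (auto simp: doubleton_eq_iff)
  qed
  have NS: "N \<subseteq> S \<times> S"
    using \<rho> by (auto simp: N_def S_def)
  have symN: "sym N"
  proof (rule symI)
    fix x y assume "(x, y) \<in> N"
    then obtain K i where "atom K" "x = (\<rho> K i, i)" "y = (\<rho> K (\<not> i), \<not> i)"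
      by (auto simp: N_def)
    then show "(y, x) \<in> N"
      unfolding N_def by (auto intro!: exI[of _ K] exI[of _ "\<not> i"])
  qed
  have svN: "single_valued N"
  proof (rule single_valuedI)
    fix x y z assume "(x, y) \<in> N" "(x, z) \<in> N"
    then obtain K L i where "atom K" "atom L" "x = (\<rho> K i, i)" "y = (\<rho> K (\<not> i), \<not> i)"
      "\<rho> K i = \<rho> L i" "z = (\<rho> L (\<not> i), \<not> i)"
      by (auto simp: N_def)
    moreover from this have "K = L"
      using atom_disj[of K L "\<rho> K i"] \<rho> by metis
    ultimately show "y = z" by simp
  qed

  \<comment> \<open>Counting edges and roots by signed slots\<close>
  define E where "E X i = {e \<in> M i. ends G e \<times> {i} \<subseteq> X}" for X and i :: bool
  have E_cases: "e \<in> E (S - X) i \<or> e \<in> E X i" if e: "e \<in> M i" and X: "P `` X \<subseteq> X" for X e i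
  proof -
    obtain u v where uv: "ends G e = {u, v}" "u \<noteq> v"
      using card_ends[OF Medge[OF e]] by (meson card_2_iff)
    then have "((u, i), (v, i)) \<in> P" "((v, i), (u, i)) \<in> P"
      using e by (auto simp: P_def insert_commute)
    moreover from this have "(u, i) \<in> S" "(v, i) \<in> S" using PS by auto
    ultimately show ?thesis
      using e X uv by (auto simp: E_def)
  qed
  have slot_sum: "sum s X = int (card {v. (v, True) \<in> X}) - int (card {v. (v, False) \<in> X})"
    if "X \<subseteq> S" for X
  proof -
    let ?X = "\<lambda>i. {v. (v, i) \<in> X}"
    have fX: "finite (?X i)" for i
      using that RV by (intro finite_subset[OF _ finite_verts]) (auto simp: S_def)
    have X: "X = ?X True \<times> {True} \<union> ?X False \<times> {False}"
    proof (rule set_eqI)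
      fix x show "x \<in> X \<longleftrightarrow> x \<in> ?X True \<times> {True} \<union> ?X False \<times> {False}"
        by (cases x; cases "snd x") auto
    qed
    have "sum s X = sum s (?X True \<times> {True}) + sum s (?X False \<times> {False})"
      by (subst X, rule sum.union_disjoint) (use fX in auto)
    moreover have "sum s (Y \<times> {i}) = int (card Y) * (if i then 1 else - 1)" for Y i
    proof -
      have "sum s (Y \<times> {i}) = (\<Sum>x\<in>Y \<times> {i}. if i then 1 else - 1)"
        by (rule sum.cong) (auto simp: s_def)
      then show ?thesis by (simp add: card_cartesian_product)
    qed
    ultimately show ?thesis by simp
  qed
  \<comment> \<open>Each matching edge inside \<open>X\<close> accounts for two slots of its own
    side. This also yields the parity required by \<open>balanced_swap\<close>.\<close>
  have edge_sum: "sum s (X \<inter> Domain P) = 2 * (int (card (E X True)) - int (card (E X False)))"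
    if X: "X \<subseteq> S" "P `` X \<subseteq> X" for X
  proof -
    have "{v. (v, i) \<in> X \<inter> Domain P} = (\<Union>e\<in>E X i. ends G e)" for i
    proof (intro equalityI subsetI)
      fix v assume "v \<in> {v. (v, i) \<in> X \<inter> Domain P}"
      then obtain e u where e: "(v, i) \<in> X" "e \<in> M i" "ends G e = {v, u}" "((v, i), (u, i)) \<in> P"
        by (auto simp: P_def)
      then have "(u, i) \<in> X" using X(2) by blast
      then have "e \<in> E X i" using e by (auto simp: E_def)
      then show "v \<in> (\<Union>e\<in>E X i. ends G e)" using e(3) by blast
    next
      fix v assume "v \<in> (\<Union>e\<in>E X i. ends G e)"
      then obtain e where e: "e \<in> M i" "ends G e \<times> {i} \<subseteq> X" "v \<in> ends G e"
        by (auto simp: E_def)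
      then obtain u where "ends G e = {v, u}" "v \<noteq> u"
        using card_2_other[OF card_ends[OF Medge[OF e(1)]] e(3)] by blast
      then have "((v, i), (u, i)) \<in> P" using e(1) by (auto simp: P_def)
      then show "v \<in> {v. (v, i) \<in> X \<inter> Domain P}" using e by auto
    qed
    moreover have "card (\<Union>e\<in>E X i. ends G e) = 2 * card (E X i)" for i
    proof -
      have "card (\<Union>e\<in>E X i. ends G e) = (\<Sum>e\<in>E X i. card (ends G e))"
      proof (rule card_UN_disjoint)
        show "finite (E X i)" using finM by (auto simp: E_def)
        show "\<forall>e\<in>E X i. finite (ends G e)"
          using ends_subset Medge finite_verts finite_subset by (metis (no_types, lifting) E_def mem_Collect_eq)
        show "\<forall>e\<in>E X i. \<forall>f\<in>E X i. e \<noteq> f \<longrightarrow> ends G e \<inter> ends G f = {}"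
          using Mmatch by (auto simp: E_def)
      qed
      also have "\<dots> = (\<Sum>e\<in>E X i. 2)"
        by (rule sum.cong) (use card_ends Medge in \<open>auto simp: E_def\<close>)
      finally show ?thesis by simp
    qed
    ultimately show ?thesis
      using slot_sum[of "X \<inter> Domain P"] X(1) by (simp add: le_infI1 right_diff_distrib)
  qed

  \<comment> \<open>Choosing the slots to exchange\<close>
  obtain X where X: "X \<subseteq> S" "P `` X \<subseteq> X" "N `` X \<subseteq> X"
    and bal: "\<bar>sum s (S - X) - sum s X\<bar> \<le> 2"
    "\<bar>sum s ((S - X) \<inter> Domain P) - sum s (X \<inter> Domain P)\<bar> \<le> 4"
    "\<bar>(sum s ((S - X) \<inter> Domain P) - sum s (X \<inter> Domain P)) - 2 * (sum s (S - X) - sum s X)\<bar> \<le> 2"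
  proof (rule balanced_swap[OF finS PS symP svP NS symN svN, of s])
    show "\<bar>s x\<bar> \<le> 1" for x by (simp add: s_def)
    show "s y = - s x" if "(x, y) \<in> N" for x y
      using that by (auto simp: N_def s_def)
    show "even (sum s (X \<inter> Domain P))" if "X \<subseteq> S" "P `` X \<subseteq> X" for X
      using edge_sum[OF that] by simp
  qed
  have PcX: "P `` (S - X) \<subseteq> S - X"
    using PS symP X(2) unfolding sym_def by blast
  have Nswap: "(\<rho> K i, i) \<in> X \<longleftrightarrow> (\<rho> K (\<not> i), \<not> i) \<in> X" if "atom K" for K i
  proof -
    have "((\<rho> K i, i), (\<rho> K (\<not> i), \<not> i)) \<in> N" using that by (auto simp: N_def)
    then show ?thesis using X(3) symN unfolding sym_def by blast
  qed
  \<comment> \<open>No arc of \<open>D\<close> ends at a common root, so it forms a source component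
    by itself and its two slots are linked. They move together, which preserves the intersection of
    the root sets.\<close>
  have both: "(v, i) \<in> X \<longleftrightarrow> (v, \<not> i) \<in> X" if v: "v \<in> R i" "v \<in> R (\<not> i)" for v i
  proof -
    have "v \<notin> ?h ` D" using v by (cases i) (auto simp: R_def D_def)
    then have K: "atom {v}"
      using v(1) RV by (auto simp: atom_def src_def enters_def subset_singleton_iff)
    then have "\<rho> {v} j = v" for j using \<rho>[OF K, of j] by simp
    then show ?thesis using Nswap[OF K, of i] by simp
  qed

  \<comment> \<open>The exchanged forests\<close>
  define M' where "M' i = E (S - X) i \<union> E X (\<not> i)" for i
  define R' where "R' i = {v. (v, i) \<in> S - X} \<union> {v. (v, \<not> i) \<in> X}" for i
  have XR: "v \<in> R i" if "(v, i) \<in> X" for v i using that X(1) by (auto simp: S_def)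
  have R'R: "R' True \<union> R' False = R True \<union> R False" "R' True \<inter> R' False = R True \<inter> R False"
    using both[of _ True] XR by (auto simp: R'_def S_def)
  \<comment> \<open>If the chosen root for side \<open>i\<close> leaves, its partner in
    \<open>K\<close> moves over to side \<open>i\<close>.\<close>
  have meets: "K \<inter> R' i \<noteq> {}" if "atom K" for K i
    using Nswap[OF that, of i] \<rho>[OF that] by (cases "(\<rho> K i, i) \<in> X") (auto simp: R'_def S_def)
  obtain B' where B': "\<And>i. branching ?t ?h ?V (R' i) (B' i)"
    "B' True \<union> B' False = D" "B' True \<inter> B' False = {}"
  proof (rule branching_roots_exchange[of ?V D ?t ?h R B R'])
    show "finite ?V" by (rule finite_verts)
    show "finite D" using finB by (simp add: D_def)
    show "?t ` D \<subseteq> ?V" using DA tail_in_verts by blast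
    show "K \<inter> R' i \<noteq> {}" if "K \<subseteq> ?V" "K \<noteq> {}" "\<forall>a\<in>D. \<not> enters ?t ?h K a"
      "\<And>L. L \<subseteq> K \<Longrightarrow> L \<noteq> {} \<Longrightarrow> \<forall>a\<in>D. \<not> enters ?t ?h L a \<Longrightarrow> L = K" for K i
      using that by (intro meets) (auto simp: atom_def src_def)
  qed (use Bbr RV D_def disjB R'R in auto)
  have R'V: "R' i \<subseteq> ?V" for i
    using RV XR unfolding R'_def S_def by blast
  have B'D: "B' i \<subseteq> D" for i using B'(2) by (cases i) auto
  have finB': "finite (B' i)" for i
    using finite_subset[OF B'D[of i]] finB by (simp add: D_def)
  have EM: "E Y j \<subseteq> M j" for Y j by (simp add: E_def)
  have M'M: "M' i \<subseteq> M True \<union> M False" for i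
    using EM[of "S - X" i] EM[of X "\<not> i"] by (cases i) (auto simp: M'_def)
  have M'edges: "M' i \<subseteq> edges G" for i
    using M'M[of i] by (auto simp: M_def)
  have MB': "M' i \<inter> B' j = {}" for i j
    using M'edges[of i] B'D[of j] DA edges_arcs_disjoint by blast
  have hB': "?h ` B' i = ?V - R' i" and injB': "inj_on ?h (B' i)" for i
    using B'(1)[of i] by (auto simp: branching_def)

  define F' where "F' i = M' i \<union> B' i" for i
  have FE: "F' i \<inter> edges G = M' i" and FA: "F' i \<inter> arcs G = B' i" for i
    using M'edges[of i] B'D[of i] DA edges_arcs_disjoint by (auto simp: F'_def)
  have M'R: "ends G e \<subseteq> R' i" if "e \<in> M' i" for e i
    using that by (auto simp: M'_def R'_def E_def)
  have ne: "ends G e \<noteq> {}" if "e \<in> M i" for e i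
    using card_ends[OF Medge[OF that]] by auto
  \<comment> \<open>A staying edge and an arriving edge with a common end would make this end a root
    on both sides, with only one of its slots moving.\<close>
  have clash: False if e: "e \<in> E (S - X) i" "f \<in> E X (\<not> i)" and v: "v \<in> ends G e" "v \<in> ends G f"
    for e f v i
    using both[of v i] e v XR[of v "\<not> i"] by (auto simp: E_def S_def)
  have M'match: "e = f" if "e \<in> M' i" "f \<in> M' i" "v \<in> ends G e" "v \<in> ends G f" for e f v i
  proof -
    have "e \<in> E (S - X) i \<or> e \<in> E X (\<not> i)" "f \<in> E (S - X) i \<or> f \<in> E X (\<not> i)"
      using that(1,2) by (simp_all add: M'_def)
    then show ?thesis
      using clash[of e i f v] clash[of f i e v] Mmatch[of e i f v] Mmatch[of e "\<not> i" f v]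
        that(3,4) EM by blast
  qed
  have "matching_forest G (F' i)" for i
    unfolding matching_forest_iff FE FA
  proof (intro conjI)
    show "F' i \<subseteq> edges G \<union> arcs G"
      using M'edges[of i] B'D[of i] DA unfolding F'_def by blast
    show "\<forall>e\<in>M' i. ends G e \<inter> ?h ` B' i = {}"
      using M'R hB' by blast
    show "\<forall>e\<in>M' i. \<forall>f\<in>M' i. ends G e \<inter> ends G f \<noteq> {} \<longrightarrow> e = f"
      using M'match by blast
    have "?V - ?h ` B' i = R' i" using hB' R'V by blast
    then show "branching ?t ?h ?V (?V - ?h ` B' i) (B' i)" using B'(1) by simp
  qed
  moreover have Edisj: "E (S - X) j \<inter> E X j = {}" for j
  proof (rule equals0I)
    fix e assume e: "e \<in> E (S - X) j \<inter> E X j"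
    then obtain v where "v \<in> ends G e" using ne EM by blast
    then show False using e by (auto simp: E_def)
  qed
  have "M' True \<inter> M' False = {}"
    using disjM EM[of "S - X" True] EM[of X True] EM[of "S - X" False] EM[of X False]
      Edisj[of True] Edisj[of False] unfolding M'_def by auto
  then have "F' True \<inter> F' False = {}"
    using B'(3) MB'[of True False] MB'[of False True] unfolding F'_def by blast
  moreover have "M' True \<union> M' False = M True \<union> M False"
    using M'M E_cases[OF _ X(2)] unfolding M'_def by fastforce
  then have "F' True \<union> F' False = F True \<union> F False"
    using B'(2) F unfolding F'_def D_def by blast
  moreover have finM': "finite (M' i)" for i
    using M'M finM finite_subset by (metis finite_UnI)
  then have cardF': "card (F' i) = card (M' i) + card (B' i)" for i
    unfolding F'_def using finB' MB' by (intro card_Un_disjoint)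

  \<comment> \<open>Sizes after the exchange\<close>
  have finE: "finite (E Y i)" for Y i using finM by (auto simp: E_def)
  have cardM': "card (M' i) = card (E (S - X) i) + card (E X (\<not> i))" for i
    unfolding M'_def using finE disjMi[of i] by (intro card_Un_disjoint) (auto simp: E_def)
  have cardR': "card (R' i) = card {v. (v, i) \<in> S - X} + card {v. (v, \<not> i) \<in> X}" for i
    unfolding R'_def
  proof (rule card_Un_disjoint)
    show "finite {v. (v, i) \<in> S - X}" "finite {v. (v, \<not> i) \<in> X}"
      using R'V[of i] finite_verts finite_subset unfolding R'_def by (metis Un_subset_iff)+
    show "{v. (v, i) \<in> S - X} \<inter> {v. (v, \<not> i) \<in> X} = {}"
      using both XR by (auto simp: S_def)
  qed
  \<comment> \<open>Every vertex is either a root or the head of exactly one arc, so branching sizes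
    differ by the negative of the difference between root counts.\<close>
  have cardB': "card (B' i) + card (R' i) = card ?V" for i
  proof -
    have "card (B' i) = card (?V - R' i)"
      using card_image[OF injB'[of i]] hB' by simp
    then show ?thesis
      using card_Diff_subset[OF finite_subset[OF R'V finite_verts] R'V, of i]
        card_mono[OF finite_verts R'V, of i] by simp
  qed
  have m: "2 * (int (card (M' True)) - int (card (M' False))) =
      sum s ((S - X) \<inter> Domain P) - sum s (X \<inter> Domain P)"
    using cardM'[of True] cardM'[of False] edge_sum[OF X(1,2)] edge_sum[OF _ PcX] by simp
  have r: "int (card (R' True)) - int (card (R' False)) = sum s (S - X) - sum s X"
    using cardR'[of True] cardR'[of False] slot_sum[OF X(1)] slot_sum[of "S - X"] by simp
  have b: "int (card (B' True)) - int (card (B' False)) = - (sum s (S - X) - sum s X)"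
    using cardB'[of True] cardB'[of False] r by linarith
  have "\<bar>int (card (M' True)) - int (card (M' False))\<bar> \<le> 2"
  proof -
    have "\<bar>x\<bar> \<le> 2" if "2 * x = y" "\<bar>y\<bar> \<le> 4" for x y :: int
      using that by arith
    then show ?thesis using m bal(2) by blast
  qed
  moreover have "\<bar>int (card (B' True)) - int (card (B' False))\<bar> \<le> 2"
    using b bal(1) by linarith
  moreover have "\<bar>int (card (F' True)) - int (card (F' False))\<bar> \<le> 1"
  proof -
    have "\<bar>x + z\<bar> \<le> 1" if "2 * x = y" "z = - r" "\<bar>y - 2 * r\<bar> \<le> 2" for x y z r :: int
      using that by arith
    from this[OF m b bal(3)] show ?thesis
      using cardF'[of True] cardF'[of False] by (simp add: algebra_simps)
  qed
  ultimately show ?thesis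
    using that[of F'] FE FA by simp
qed

end

text \<open>
  Twice a sum of two squares is the square of the sum plus the square of the difference, so only the
  differences matter, and these keep their parities. The weight 3 makes up for a possible growth of
  the two smaller terms.
\<close>

lemma potential_decreases:
  fixes m1 m2 b1 b2 m1' m2' b1' b2' :: int
  assumes m: "m1' + m2' = m1 + m2" and b: "b1' + b2' = b1 + b2"
    and good: "\<bar>(m1' + b1') - (m2' + b2')\<bar> \<le> 1" "\<bar>m1' - m2'\<bar> \<le> 2" "\<bar>b1' - b2'\<bar> \<le> 2"
    and bad: "\<not> (\<bar>(m1 + b1) - (m2 + b2)\<bar> \<le> 1 \<and> \<bar>m1 - m2\<bar> \<le> 2 \<and> \<bar>b1 - b2\<bar> \<le> 2)"
  shows "3 * (m1' + b1')\<^sup>2 + m1'\<^sup>2 + b1'\<^sup>2 + (3 * (m2' + b2')\<^sup>2 + m2'\<^sup>2 + b2'\<^sup>2)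
       < 3 * (m1 + b1)\<^sup>2 + m1\<^sup>2 + b1\<^sup>2 + (3 * (m2 + b2)\<^sup>2 + m2\<^sup>2 + b2\<^sup>2)"
proof -
  define x y where "x = m1 - m2" and "y = b1 - b2"
  define x' y' where "x' = m1' - m2'" and "y' = b1' - b2'"
  have sq: "2 * (3 * (p + q)\<^sup>2 + p\<^sup>2 + q\<^sup>2 + (3 * (p' + q')\<^sup>2 + p'\<^sup>2 + q'\<^sup>2)) =
      3 * ((p + p') + (q + q'))\<^sup>2 + (p + p')\<^sup>2 + (q + q')\<^sup>2 +
      (3 * ((p - p') + (q - q'))\<^sup>2 + (p - p')\<^sup>2 + (q - q')\<^sup>2)" for p q p' q' :: int
    by (simp add: power2_eq_square algebra_simps)
  have par: "\<exists>k. x = x' + 2 * k" "\<exists>k. y = y' + 2 * k"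
    unfolding x_def y_def x'_def y'_def using m b by presburger+
  then obtain i j where ij: "x = x' + 2 * i" "y = y' + 2 * j" by blast
  have x'c: "x' = -2 \<or> x' = -1 \<or> x' = 0 \<or> x' = 1 \<or> x' = 2" and y'c: "y' = -2 \<or> y' = -1 \<or> y' = 0 \<or> y' = 1 \<or> y' = 2"
    and fc: "\<bar>x' + y'\<bar> \<le> 1"
    using good by (auto simp: x'_def y'_def)
  have sq_mono: "a\<^sup>2 \<le> c\<^sup>2" if "\<bar>a\<bar> \<le> \<bar>c\<bar>" for a c :: int
    using that by (simp add: abs_le_square_iff)
  have bad': "\<bar>x + y\<bar> \<ge> 2 \<or> \<bar>x\<bar> \<ge> 3 \<or> \<bar>y\<bar> \<ge> 3"
    using bad unfolding x_def y_def by linarith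
  have "3 * (x' + y')\<^sup>2 + x'\<^sup>2 + y'\<^sup>2 < 3 * (x + y)\<^sup>2 + x\<^sup>2 + y\<^sup>2"
  proof (cases "\<bar>x + y\<bar> \<ge> 2")
    case True
    have small: "x'\<^sup>2 \<le> 4" "y'\<^sup>2 \<le> 4" using x'c y'c by auto
    have pos: "0 \<le> x\<^sup>2" "0 \<le> y\<^sup>2" by simp_all
    have "x' + y' = -1 \<or> x' + y' = 0 \<or> x' + y' = 1" using fc by arith
    \<comment> \<open>Parity matters here: if \<open>x' + y'\<close> is odd, so is
      \<open>x + y\<close>, which then is at least 3 in absolute value. Three times the gain of 4
      exceeds the two small squares, at most 4 each.\<close>
    then have "(x' + y')\<^sup>2 + 4 \<le> (x + y)\<^sup>2"
    proof (elim disjE)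
      assume "x' + y' = 0"
      then show ?thesis using sq_mono[of 2 "x + y"] True by simp
    next
      assume f: "x' + y' = -1"
      then have "\<bar>x + y\<bar> \<ge> 3" using True ij by presburger
      then show ?thesis using sq_mono[of 3 "x + y"] f by simp
    next
      assume f: "x' + y' = 1"
      then have "\<bar>x + y\<bar> \<ge> 3" using True ij by presburger
      then show ?thesis using sq_mono[of 3 "x + y"] f by simp
    qed
    then show ?thesis using small pos by linarith
  next
    case False
    then have f: "(x + y)\<^sup>2 = (x' + y')\<^sup>2"
    proof -
      have "x + y = x' + y' \<or> x + y = - (x' + y')"
        using False fc ij by presburger
      then show ?thesis by (elim disjE) (simp_all only: power2_minus)
    qed
    \<comment> \<open>As \<open>x + y\<close> is small, one entry of absolute value at least 3
      forces the other to at least 2. Hence the squares total at least 13, against at most 8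
      afterwards.\<close>
    have big: "\<bar>x\<bar> \<ge> 2" "\<bar>y\<bar> \<ge> 2" "\<bar>x\<bar> \<ge> 3 \<or> \<bar>y\<bar> \<ge> 3"
      using False bad' by linarith+
    have "x'\<^sup>2 \<le> 4" "y'\<^sup>2 \<le> 4" using x'c y'c by auto
    moreover have "4 \<le> x\<^sup>2" "4 \<le> y\<^sup>2"
      using sq_mono[of 2 x] sq_mono[of 2 y] big by simp_all
    moreover have "9 \<le> x\<^sup>2 \<or> 9 \<le> y\<^sup>2"
      using sq_mono[of 3 x] sq_mono[of 3 y] big by auto
    ultimately show ?thesis using f by linarith
  qed
  then show ?thesis
    using sq[of m1 b1 m2 b2] sq[of m1' b1' m2' b2'] m b
    unfolding x_def y_def x'_def y'_def by simp
qed

theorem theorem1: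
  fixes G :: "('v, 'e) mixed_graph" and k :: nat
  assumes "mixed_graph G"
    and "k \<ge> 1"
    and "\<exists>F. matching_forest_partition G k F"
  shows "\<exists>F. matching_forest_partition G k F \<and>
    (\<forall>i\<in>{1..k}. \<forall>j\<in>{1..k}.
       \<bar>int (card (F i)) - int (card (F j))\<bar> \<le> 1 \<and>
       \<bar>int (card (F i \<inter> edges G)) - int (card (F j \<inter> edges G))\<bar> \<le> 2 \<and>
       \<bar>int (card (F i \<inter> arcs G)) - int (card (F j \<inter> arcs G))\<bar> \<le> 2)"
proof -
  interpret mixed_graph G by fact
  let ?m = "\<lambda>X. int (card (X \<inter> edges G))" and ?b = "\<lambda>X. int (card (X \<inter> arcs G))"
  define w where "w X = 3 * (?m X + ?b X)\<^sup>2 + (?m X)\<^sup>2 + (?b X)\<^sup>2" for X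
  \<comment> \<open>\<open>nat\<close> makes a least value available; the sum is nonnegative by
    \<open>w0\<close>, so no information is lost.\<close>
  define \<Phi> where "\<Phi> F = nat (\<Sum>i\<in>{1..k}. w (F i))" for F
  have w0: "0 \<le> w X" for X by (simp add: w_def)
  obtain F where F: "matching_forest_partition G k F"
    and min: "\<And>F'. matching_forest_partition G k F' \<Longrightarrow> \<Phi> F \<le> \<Phi> F'"
    using assms(3) ex_has_least_nat[of "matching_forest_partition G k" _ \<Phi>] by blast
  have mf: "matching_forest G (F i)" if "i \<in> {1..k}" for i
    using F that by (simp add: matching_forest_partition_def)
  have dF: "F i \<inter> F j = {}" if "i \<in> {1..k}" "j \<in> {1..k}" "i \<noteq> j" for i j
    using F that by (simp add: matching_forest_partition_def disjoint_family_on_def)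
  have UF: "(\<Union>i\<in>{1..k}. F i) = edges G \<union> arcs G"
    using F by (simp add: matching_forest_partition_def)
  have card_mf: "int (card X) = ?m X + ?b X" if "matching_forest G X" for X
  proof -
    have "X = (X \<inter> edges G) \<union> (X \<inter> arcs G)"
      using that by (auto simp: matching_forest_def)
    moreover have "card ((X \<inter> edges G) \<union> (X \<inter> arcs G)) = card (X \<inter> edges G) + card (X \<inter> arcs G)"
      using finite_matching_forest[OF that] edges_arcs_disjoint by (intro card_Un_disjoint) auto
    ultimately show ?thesis by simp
  qed
  have "\<bar>int (card (F i)) - int (card (F j))\<bar> \<le> 1 \<and> \<bar>?m (F i) - ?m (F j)\<bar> \<le> 2 \<and>
      \<bar>?b (F i) - ?b (F j)\<bar> \<le> 2" (is "?good i j") if i: "i \<in> {1..k}" and j: "j \<in> {1..k}" for i j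
  proof (rule ccontr)
    assume bad: "\<not> ?good i j"
    then have ij: "i \<noteq> j" by auto
    have mf2: "matching_forest G (if c then F i else F j)" for c
      using mf i j by simp
    have "(if True then F i else F j) \<inter> (if False then F i else F j) = {}"
      using dF i j ij by simp
    from rebalance_two[OF mf2 this] obtain H where
      H: "\<And>c. matching_forest G (H c)" "H True \<inter> H False = {}" "H True \<union> H False = F i \<union> F j"
      "\<bar>int (card (H True)) - int (card (H False))\<bar> \<le> 1"
      "\<bar>?m (H True) - ?m (H False)\<bar> \<le> 2" "\<bar>?b (H True) - ?b (H False)\<bar> \<le> 2"
      by auto
    define F' where "F' = F(i := H True, j := H False)"
    have F'v: "F' i = H True" "F' j = H False" "\<And>l. l \<noteq> i \<Longrightarrow> l \<noteq> j \<Longrightarrow> F' l = F l"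
      using ij by (auto simp: F'_def)
    have sub: "H c \<subseteq> F i \<union> F j" for c
      using H(3) by (cases c) auto
    have "F' p \<inter> F' q = {}" if pq: "p \<in> {1..k}" "q \<in> {1..k}" "p \<noteq> q" for p q
    proof -
      have "H c \<inter> F l = {}" if "l \<in> {1..k}" "l \<noteq> i" "l \<noteq> j" for c l
        using sub[of c] dF[OF i that(1)] dF[OF j that(1)] that by blast
      then show ?thesis
        using pq H(2) dF[OF pq] by (auto simp: F'_def)
    qed
    moreover have "matching_forest G (F' p)" if "p \<in> {1..k}" for p
      using H(1) mf that by (simp add: F'_def)
    moreover have "(\<Union>p\<in>{1..k}. F' p) = (\<Union>p\<in>{1..k}. F p)"
    proof -
      have split: "(\<Union>p\<in>{1..k}. f p) = f i \<union> f j \<union> (\<Union>p\<in>{1..k} - {i, j}. f p)" for f :: "nat \<Rightarrow> 'e set"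
        using i j by blast
      have "(\<Union>p\<in>{1..k} - {i, j}. F' p) = (\<Union>p\<in>{1..k} - {i, j}. F p)"
        by (rule SUP_cong) (auto simp: F'_def)
      then show ?thesis
        unfolding split[of F'] split[of F] F'v(1,2) H(3) by simp
    qed
    ultimately have part: "matching_forest_partition G k F'"
      using UF by (simp add: matching_forest_partition_def disjoint_family_on_def)
    have sums: "card (H True \<inter> Z) + card (H False \<inter> Z) = card (F i \<inter> Z) + card (F j \<inter> Z)" for Z
    proof -
      have "card (H True \<inter> Z) + card (H False \<inter> Z) = card ((H True \<inter> Z) \<union> (H False \<inter> Z))"
        using H(1,2) finite_matching_forest by (intro card_Un_disjoint[symmetric]) auto
      also have "(H True \<inter> Z) \<union> (H False \<inter> Z) = (F i \<inter> Z) \<union> (F j \<inter> Z)"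
        using H(3) by blast
      also have "card \<dots> = card (F i \<inter> Z) + card (F j \<inter> Z)"
        using mf[OF i] mf[OF j] finite_matching_forest dF[OF i j ij] by (intro card_Un_disjoint) auto
      finally show ?thesis .
    qed
    have "w (H True) + w (H False) < w (F i) + w (F j)"
      unfolding w_def
    proof (rule potential_decreases)
      show "?m (H True) + ?m (H False) = ?m (F i) + ?m (F j)" "?b (H True) + ?b (H False) = ?b (F i) + ?b (F j)"
        using sums[of "edges G"] sums[of "arcs G"] by linarith+
      show "\<bar>(?m (H True) + ?b (H True)) - (?m (H False) + ?b (H False))\<bar> \<le> 1"
        using H(4) card_mf[OF H(1)] by simp
      show "\<not> (\<bar>(?m (F i) + ?b (F i)) - (?m (F j) + ?b (F j))\<bar> \<le> 1 \<and>
          \<bar>?m (F i) - ?m (F j)\<bar> \<le> 2 \<and> \<bar>?b (F i) - ?b (F j)\<bar> \<le> 2)"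
        using bad card_mf[OF mf[OF i]] card_mf[OF mf[OF j]] by simp
    qed (use H(5,6) in auto)
    moreover have split: "(\<Sum>p\<in>{1..k}. w (f p)) = w (f i) + w (f j) + (\<Sum>p\<in>{1..k} - {i, j}. w (f p))" for f
    proof -
      have "{1..k} - {i} - {j} = {1..k} - {i, j}" by blast
      then show ?thesis
        using sum.remove[of "{1..k}" i "\<lambda>p. w (f p)"] sum.remove[of "{1..k} - {i}" j "\<lambda>p. w (f p)"]
          i j ij by simp
    qed
    moreover have "(\<Sum>p\<in>{1..k} - {i, j}. w (F' p)) = (\<Sum>p\<in>{1..k} - {i, j}. w (F p))"
      by (rule sum.cong) (auto simp: F'_def)
    ultimately have "(\<Sum>p\<in>{1..k}. w (F' p)) < (\<Sum>p\<in>{1..k}. w (F p))"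
      unfolding split[of F'] split[of F] F'v(1,2) by linarith
    moreover have "0 \<le> (\<Sum>p\<in>{1..k}. w (F' p))"
      by (rule sum_nonneg) (rule w0)
    ultimately have "\<Phi> F' < \<Phi> F"
      unfolding \<Phi>_def by linarith
    then show False using min[OF part] by simp
  qed
  then show ?thesis using F by blast
qed

end
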